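(* For every positive integer $n$, \[ \mathrm{ex}(Q_n, C_{10}) > \frac{c}{12}\cdot e(Q_n), \qquad \text{where } c=\prod_{k=1}^\infty\left(1-\frac{1}{2^k}\right). \]
   Context: The $n$-dimensional hypercube $Q_n$ is the graph with vertex set $\{0,1\}^n$ in which two vertices are adjacent if and only if they differ in exactly one coordinate; $e(Q_n)$ denotes its number of edges. For a graph $H$, $\mathrm{ex}(Q_n,H)$ is the maximum number of edges of a subgraph of $Q_n$ containing no copy of $H$. $C_{10}$ is the cycle of length $10$. *)

theory Defs
  imports "HOL-Analysis.Infinite_Products"
begin

type_synonym 'a graph = "'a set \<times> 'a set set"

abbreviation verts :: "'a graph \<Rightarrow> 'a set" where "verts G \<equiv> fst G"
abbreviation edges :: "'a graph \<Rightarrow> 'a set set" where "edges G \<equiv> snd G"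

definition simple_graph :: "'a graph \<Rightarrow> bool" where
  "simple_graph G \<longleftrightarrow> (\<forall>e\<in>edges G. e \<subseteq> verts G \<and> card e = 2)"

definition subgraph :: "'a graph \<Rightarrow> 'a graph \<Rightarrow> bool" where
  "subgraph F G \<longleftrightarrow> simple_graph F \<and> verts F \<subseteq> verts G \<and> edges F \<subseteq> edges G"

text \<open>A copy of H in F is a not necessarily induced subgraph of F isomorphic to H,
  that is, the image of H under an injective graph homomorphism.\<close>
definition contains_copy :: "'a graph \<Rightarrow> 'b graph \<Rightarrow> bool" where
  "contains_copy F H \<longleftrightarrow>
     (\<exists>f. inj_on f (verts H) \<and> f ` verts H \<subseteq> verts F \<and> (\<forall>e\<in>edges H. f ` e \<in> edges F))"

definition ex_num :: "'a graph \<Rightarrow> 'b graph \<Rightarrow> nat" where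
  "ex_num G H = Max {card (edges F) |F. subgraph F G \<and> \<not> contains_copy F H}"

definition hypercube :: "nat \<Rightarrow> bool list graph" where
  "hypercube n =
     ({u. length u = n},
      {{u, v} |u v. length u = n \<and> length v = n \<and> card {i. i < n \<and> u ! i \<noteq> v ! i} = 1})"

definition cycle_graph :: "nat \<Rightarrow> nat graph" where
  "cycle_graph m = ({..<m}, {{i, (i + 1) mod m} |i. i < m})"

lemma simple_graph_hypercube: "simple_graph (hypercube n)"
proof -
  have "u \<noteq> v" if "card {i. i < n \<and> u ! i \<noteq> v ! i} = 1" for u v :: "bool list"
    using that by auto
  then have "card {u, v} = 2" if "card {i. i < n \<and> u ! i \<noteq> v ! i} = 1" for u v :: "bool list"
    using that by simp
  then show ?thesis
    unfolding simple_graph_def hypercube_def by force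
qed

lemma simple_graph_cycle: "m \<ge> 3 \<Longrightarrow> simple_graph (cycle_graph m)"
proof -
  assume m: "m \<ge> 3"
  have "i \<noteq> (i + 1) mod m" if "i < m" for i
    using m that by (cases "i + 1 = m") auto
  with m show ?thesis
    by (fastforce simp: simple_graph_def cycle_graph_def)
qed

lemma finite_hypercube: "finite (verts (hypercube n))" "finite (edges (hypercube n))"
proof -
  have "finite {u :: bool list. set u \<subseteq> UNIV \<and> length u = n}"
    by (rule finite_lists_length_eq) simp
  then show V: "finite (verts (hypercube n))"
    by (simp add: hypercube_def)
  have "edges (hypercube n) \<subseteq> Pow (verts (hypercube n))"
    by (auto simp: hypercube_def)
  then show "finite (edges (hypercube n))"
    using V finite_subset by blast
qed

text \<open>The set in the definition of ex_num is finite and nonempty here,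
  so its Max is a genuine maximum.\<close>
lemma ex_num_set_hypercube:
  fixes H :: "'b graph" and n :: nat
  assumes "edges H \<noteq> {}"
  defines "S \<equiv> {card (edges F) |F. subgraph F (hypercube n) \<and> \<not> contains_copy F H}"
  shows "finite S" "S \<noteq> {}"
proof -
  have "S \<subseteq> {..card (edges (hypercube n))}"
    by (auto simp: S_def subgraph_def intro: card_mono finite_hypercube)
  then show "finite S"
    using finite_subset by blast
  have "subgraph ({}, {}) (hypercube n)" "\<not> contains_copy ({} :: bool list set, {}) H"
    using assms by (auto simp: subgraph_def simple_graph_def contains_copy_def)
  then show "S \<noteq> {}"
    unfolding S_def by blast
qed

lemma convergent_prod_one_minus_half_powers:
  "convergent_prod (\<lambda>k::nat. 1 - 1 / 2 ^ (k + 1) :: real)"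
proof (rule abs_convergent_prod_imp_convergent_prod, rule summable_imp_abs_convergent_prod)
  have "summable (\<lambda>k::nat. (1/2) * (1/2 :: real) ^ k)"
    by (intro summable_mult summable_geometric) simp
  then show "summable (\<lambda>k::nat. norm (1 - 1 / 2 ^ (k + 1) - 1 :: real))"
    by (simp add: power_one_over field_simps)
qed

end

theory Submission
  imports Defs "HOL-Library.Z2" "HOL-Library.Function_Algebras"
begin

text \<open>
  An edge of the cube is a pair \<open>(A, x)\<close> with \<open>x \<notin> A\<close>, joining \<open>A\<close> to \<open>A \<union> {x}\<close>. Fix the parities of
  \<open>|A|\<close> and of \<open>|{a \<in> A. a < x}|\<close>; some choice keeps a quarter of the edges, and then every cycle
  lives in two consecutive layers. In the layers of sizes \<open>s\<close> and \<open>s + 1\<close>, assign random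
  vectors of an \<open>(s + 1)\<close>-dimensional space over the field with two elements to the points
  \<open>0, \<dots>, n\<close>, where \<open>n\<close> is an additional point, and keep
  \<open>(A, x)\<close> if the vectors on \<open>A \<union> {x}\<close> and those on \<open>A \<union> {n}\<close> are both bases. This keeps more than a
  fraction \<open>c / 2\<close> of the edges.

  A hexagon \<open>S + a, S + b, S + c, S + ab, S + bc, S + ac\<close> of kept vertices would make the six sets
  \<open>S\<close> plus two of \<open>a, b, c, n\<close> bases, which is impossible as the quotient by the span of \<open>S\<close> has only
  three nonzero vectors (the daisy argument of Ellis, Ivan and Leader).

  In a 10-cycle within two layers every direction is used exactly twice, at odd cyclic distance at
  least 3, so the cycle is a chord diagram with five chords on ten points. The second parity says that
  every direction is crossed by an even number of smaller directions. Of the thirteen possible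
  diagrams, five contain a hexagon; the crossing graphs of the others are the pentagon, \<open>K\<^sub>5\<close>, and an
  edge joined to three isolated vertices, and none of these admits such an ordering. So the
  construction even gives the density \<open>c / 8\<close>.
\<close>

section \<open>Chord diagrams of 10-cycles\<close>

text \<open>Around the pentagon \<open>a\<close>, \<open>b\<close>, \<open>c\<close>,
  \<open>d\<close>, \<open>e\<close> every vertex is a local minimum or a local maximum. The two
  kinds alternate, which is impossible on an odd cycle.\<close>

lemma no_even_pentagon:
  fixes a b c d e :: nat
  assumes "(b < a) = (e < a)" "(a < b) = (c < b)" "(b < c) = (d < c)" "(c < d) = (e < d)" "(d < e) = (a < e)"
   "a \<noteq> b" "b \<noteq> c" "c \<noteq> d" "d \<noteq> e" "e \<noteq> a"
  shows False
proof -
  have "(a < b) = (c < b)" by fact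
  also have "\<dots> = (\<not> b < c)" using assms(7) by auto
  also have "\<dots> = (\<not> d < c)" using assms(3) by simp
  also have "\<dots> = (c < d)" using assms(8) by auto
  also have "\<dots> = (e < d)" by fact
  also have "\<dots> = (\<not> d < e)" using assms(9) by auto
  also have "\<dots> = (\<not> a < e)" using assms(5) by simp
  also have "\<dots> = (e < a)" using assms(10) by auto
  also have "\<dots> = (b < a)" using assms(1) by simp
  also have "\<dots> = (\<not> a < b)" using assms(6) by auto
  finally show False by simp
qed

text \<open>Here \<open>b\<close> and \<open>d\<close> are the ends of the edge, and
  \<open>a\<close>, \<open>c\<close>, \<open>e\<close> are the isolated vertices joined to both.
  Each of \<open>a\<close>, \<open>c\<close>, \<open>e\<close> lies on the same side of
  \<open>b\<close> as of \<open>d\<close>, so these three contribute equally to both counts. The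
  edge contributes to exactly one of them, so the two parities differ. An equation of the form
  \<open>(p = q) = (r = s)\<close> says that an even number of the four hold.\<close>

lemma no_even_K2_join:
  fixes a b c d e :: nat
  assumes "(d < a) = (b < a)" "(d < e) = (b < e)" "(d < c) = (b < c)"
    "((a < b) = (c < b)) = ((e < b) = (d < b))" "((b < d) = (a < d)) = ((c < d) = (e < d))"
    "b \<noteq> d" "a \<noteq> b" "a \<noteq> d" "c \<noteq> b" "c \<noteq> d" "e \<noteq> b" "e \<noteq> d"
  shows False
proof -
  have "(a < d) = (a < b)" "(c < d) = (c < b)" "(e < d) = (e < b)" "(d < b) = (\<not> b < d)"
    using assms(1,2,3,6-12) by (metis not_less_iff_gr_or_eq)+
  then show False
    using assms(4,5) by (cases "a < b"; cases "c < b"; cases "e < b"; cases "b < d") simp_all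
qed

text \<open>The second smallest vertex \<open>x\<close> of a complete graph has exactly one smaller
  neighbour, the minimum \<open>m\<close>.\<close>

lemma no_even_K5:
  fixes a b c d e :: nat
  assumes "((b < a) = (c < a)) = ((d < a) = (e < a))" "((a < b) = (c < b)) = ((d < b) = (e < b))"
   "((a < c) = (b < c)) = ((d < c) = (e < c))" "((a < d) = (b < d)) = ((c < d) = (e < d))"
   "((a < e) = (b < e)) = ((c < e) = (d < e))"
   "distinct [a,b,c,d,e]"
  shows False
proof -
  define S where "S = {a,b,c,d,e}"
  define m where "m = Min S"
  define x where "x = Min (S - {m})"
  have c: "card S = 5" using assms by (simp add: S_def)
  have m: "m \<in> S" unfolding m_def by (rule Min_in) (simp_all add: S_def)
  have ne: "S - {m} \<noteq> {}"
  proof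
    assume "S - {m} = {}"
    then have "card S \<le> card {m}" by (intro card_mono) auto
    then show False using c by simp
  qed
  have x: "x \<in> S" "x \<noteq> m"
    using Min_in[OF _ ne] unfolding x_def by (auto simp: S_def)
  have le: "y < x \<longleftrightarrow> y = m" if "y \<in> S" for y
  proof
    have "m \<le> x" unfolding m_def using x(1) by (intro Min_le) (auto simp: S_def)
    then show "y = m \<Longrightarrow> y < x" using x by auto
    show "y < x \<Longrightarrow> y = m" 
      using that Min_le[of "S - {m}" y] unfolding x_def by (fastforce simp: S_def)
  qed
  \<comment> \<open>Exactly one of the four neighbours of \<open>x\<close> equals \<open>m\<close>,
    which is an odd number.\<close>
  have no: False if "((p = m) = (q = m)) = ((r = m) = (s = m))" "m \<in> {p, q, r, s}" "distinct [p, q, r, s]"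
    for p q r s
    using that by auto
  have ab: "a < x \<longleftrightarrow> a = m" "b < x \<longleftrightarrow> b = m" "c < x \<longleftrightarrow> c = m" "d < x \<longleftrightarrow> d = m" "e < x \<longleftrightarrow> e = m"
    by (simp_all add: le S_def)
  consider "x = a" | "x = b" | "x = c" | "x = d" | "x = e"
    using x by (auto simp: S_def)
  then show False
  proof cases
    case 1
    show False by (rule no[OF assms(1)[folded 1, unfolded ab]]) (use m x(2) 1 assms(6) in \<open>auto simp: S_def\<close>)
  next
    case 2
    show False by (rule no[OF assms(2)[folded 2, unfolded ab]]) (use m x(2) 2 assms(6) in \<open>auto simp: S_def\<close>)
  next
    case 3
    show False by (rule no[OF assms(3)[folded 3, unfolded ab]]) (use m x(2) 3 assms(6) in \<open>auto simp: S_def\<close>)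
  next
    case 4
    show False by (rule no[OF assms(4)[folded 4, unfolded ab]]) (use m x(2) 4 assms(6) in \<open>auto simp: S_def\<close>)
  next
    case 5
    show False by (rule no[OF assms(5)[folded 5, unfolded ab]]) (use m x(2) 5 assms(6) in \<open>auto simp: S_def\<close>)
  qed
qed
text \<open>The directions \<open>d0\<close> to \<open>d9\<close> around the cycle form a chord
  diagram that joins even to odd positions. The assumptions \<open>g3\<close> and \<open>g5\<close>
  count smaller directions on one arc of a chord of length 3 or 5. A chord with both ends on the arc
  is counted twice, so only crossing chords affect the parity. The assumptions \<open>hex\<close>
  exclude two neighbouring parallel chords of length 3.\<close>

lemma no_compatible_ordering:
  fixes d0 d1 d2 d3 d4 d5 d6 d7 d8 d9 :: nat
  assumes m0: "d0 = d3 \<or> d0 = d5 \<or> d0 = d7" and m2: "d2 = d5 \<or> d2 = d7 \<or> d2 = d9"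
    and m4: "d4 = d7 \<or> d4 = d9 \<or> d4 = d1" and m6: "d6 = d9 \<or> d6 = d1 \<or> d6 = d3"
    and m8: "d8 = d1 \<or> d8 = d3 \<or> d8 = d5"
    and dist: "distinct [d0, d2, d4, d6, d8]"
    and g3: "d0 = d3 \<Longrightarrow> d1 < d0 \<longleftrightarrow> d2 < d0" "d1 = d4 \<Longrightarrow> d2 < d1 \<longleftrightarrow> d3 < d1"
      "d2 = d5 \<Longrightarrow> d3 < d2 \<longleftrightarrow> d4 < d2" "d3 = d6 \<Longrightarrow> d4 < d3 \<longleftrightarrow> d5 < d3"
      "d4 = d7 \<Longrightarrow> d5 < d4 \<longleftrightarrow> d6 < d4" "d5 = d8 \<Longrightarrow> d6 < d5 \<longleftrightarrow> d7 < d5"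
      "d6 = d9 \<Longrightarrow> d7 < d6 \<longleftrightarrow> d8 < d6" "d7 = d0 \<Longrightarrow> d8 < d7 \<longleftrightarrow> d9 < d7"
      "d8 = d1 \<Longrightarrow> d9 < d8 \<longleftrightarrow> d0 < d8" "d9 = d2 \<Longrightarrow> d0 < d9 \<longleftrightarrow> d1 < d9"
    and g5: "d0 = d5 \<Longrightarrow> (d1 < d0 \<longleftrightarrow> d2 < d0) \<longleftrightarrow> (d3 < d0 \<longleftrightarrow> d4 < d0)"
      "d1 = d6 \<Longrightarrow> (d2 < d1 \<longleftrightarrow> d3 < d1) \<longleftrightarrow> (d4 < d1 \<longleftrightarrow> d5 < d1)"
      "d2 = d7 \<Longrightarrow> (d3 < d2 \<longleftrightarrow> d4 < d2) \<longleftrightarrow> (d5 < d2 \<longleftrightarrow> d6 < d2)"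
      "d3 = d8 \<Longrightarrow> (d4 < d3 \<longleftrightarrow> d5 < d3) \<longleftrightarrow> (d6 < d3 \<longleftrightarrow> d7 < d3)"
      "d4 = d9 \<Longrightarrow> (d5 < d4 \<longleftrightarrow> d6 < d4) \<longleftrightarrow> (d7 < d4 \<longleftrightarrow> d8 < d4)"
    and hex: "\<not> (d0 = d3 \<and> d1 = d4)" "\<not> (d1 = d4 \<and> d2 = d5)" "\<not> (d2 = d5 \<and> d3 = d6)"
      "\<not> (d3 = d6 \<and> d4 = d7)" "\<not> (d4 = d7 \<and> d5 = d8)" "\<not> (d5 = d8 \<and> d6 = d9)"
      "\<not> (d6 = d9 \<and> d7 = d0)" "\<not> (d7 = d0 \<and> d8 = d1)" "\<not> (d8 = d1 \<and> d9 = d2)"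
      "\<not> (d9 = d2 \<and> d0 = d3)"
  shows False
proof -
  have ne: "d0 \<noteq> d2" "d0 \<noteq> d4" "d0 \<noteq> d6" "d0 \<noteq> d8" "d2 \<noteq> d4" "d2 \<noteq> d6" "d2 \<noteq> d8"
    "d4 \<noteq> d6" "d4 \<noteq> d8" "d6 \<noteq> d8"
    using dist by simp_all
  \<comment> \<open>Excluding hexagons leaves eight diagrams: two with all chords of cyclic length
    3, one with five diameters, and the five rotations of two opposite chords of length 3 together
    with three diameters.\<close>
  have M: "d0 = d3 \<and> d2 = d5 \<and> d4 = d7 \<and> d6 = d9 \<and> d8 = d1
    \<or> d0 = d7 \<and> d2 = d9 \<and> d4 = d1 \<and> d6 = d3 \<and> d8 = d5
    \<or> d0 = d5 \<and> d2 = d7 \<and> d4 = d9 \<and> d6 = d1 \<and> d8 = d3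
    \<or> d0 = d3 \<and> d2 = d7 \<and> d4 = d9 \<and> d6 = d1 \<and> d8 = d5
    \<or> d0 = d5 \<and> d2 = d7 \<and> d4 = d9 \<and> d6 = d3 \<and> d8 = d1
    \<or> d0 = d5 \<and> d2 = d7 \<and> d4 = d1 \<and> d6 = d9 \<and> d8 = d3
    \<or> d0 = d5 \<and> d2 = d9 \<and> d4 = d7 \<and> d6 = d1 \<and> d8 = d3
    \<or> d0 = d7 \<and> d2 = d5 \<and> d4 = d9 \<and> d6 = d1 \<and> d8 = d3"
    using m0 m2 m4 m6 m8 ne hex by (smt (verit))
  show False
    using M
  proof (elim disjE conjE)
    assume e: "d0 = d3" "d2 = d5" "d4 = d7" "d6 = d9" "d8 = d1"
    show False
      by (rule no_even_pentagon[where a = d0 and b = d2 and c = d4 and d = d6 and e = d8]; (use dist in \<open>simp; fail\<close>)?; metis e ne g3 g5)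
  next
    assume e: "d0 = d7" "d2 = d9" "d4 = d1" "d6 = d3" "d8 = d5"
    show False
      by (rule no_even_pentagon[where a = d0 and b = d2 and c = d4 and d = d6 and e = d8]; (use dist in \<open>simp; fail\<close>)?; metis e ne g3 g5)
  next
    assume e: "d0 = d5" "d2 = d7" "d4 = d9" "d6 = d1" "d8 = d3"
    show False
      by (rule no_even_K5[where a = d0 and b = d2 and c = d4 and d = d6 and e = d8]; (use dist in \<open>simp; fail\<close>)?; metis e ne g3 g5)
  next
    \<comment> \<open>The remaining diagrams arise from this one by repeated rotation by two points,
      and the roles of the directions rotate along.\<close>
    assume e: "d0 = d3" "d2 = d7" "d4 = d9" "d6 = d1" "d8 = d5"
    show False
      by (rule no_even_K2_join[where a = d0 and b = d2 and c = d4 and d = d6 and e = d8]; (use dist in \<open>simp; fail\<close>)?; metis e ne g3 g5)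
  next
    assume e: "d0 = d5" "d2 = d7" "d4 = d9" "d6 = d3" "d8 = d1"
    show False
      by (rule no_even_K2_join[where a = d8 and b = d0 and c = d2 and d = d4 and e = d6]; (use dist in \<open>simp; fail\<close>)?; metis e ne g3 g5)
  next
    assume e: "d0 = d5" "d2 = d7" "d4 = d1" "d6 = d9" "d8 = d3"
    show False
      by (rule no_even_K2_join[where a = d6 and b = d8 and c = d0 and d = d2 and e = d4]; (use dist in \<open>simp; fail\<close>)?; metis e ne g3 g5)
  next
    assume e: "d0 = d5" "d2 = d9" "d4 = d7" "d6 = d1" "d8 = d3"
    show False
      by (rule no_even_K2_join[where a = d4 and b = d6 and c = d8 and d = d0 and e = d2]; (use dist in \<open>simp; fail\<close>)?; metis e ne g3 g5)
  next
    assume e: "d0 = d7" "d2 = d5" "d4 = d9" "d6 = d1" "d8 = d3"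
    show False
      by (rule no_even_K2_join[where a = d2 and b = d4 and c = d6 and d = d8 and e = d0]; (use dist in \<open>simp; fail\<close>)?; metis e ne g3 g5)
  qed
qed

section \<open>From a 10-cycle to its chord diagram\<close>

text \<open>For one fixed direction, \<open>e k\<close> says that step \<open>i + k\<close> uses it
  and \<open>b k\<close> that it is present before that step. Its uses alternately insert and delete
  it, so by \<open>up\<close> consecutive uses are at odd distance, and by \<open>nadj\<close> at
  distance at least 3. Periodicity makes their number even, and four uses would need a cycle of
  length at least 12.\<close>

lemma ten_cycle_matching_aux:
  fixes e b :: "nat \<Rightarrow> bool"
  assumes step: "\<And>k. b (Suc k) \<longleftrightarrow> b k \<noteq> e k"
    and per: "b 10 = b 0" "e 10 = e 0"
    and up: "\<And>k. e k \<Longrightarrow> b k \<longleftrightarrow> odd (i + k)"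
    and nadj: "\<And>k. \<not> (e k \<and> e (Suc k))"
    and e0: "e 0"
  shows "\<not> e 1 \<and> \<not> e 2 \<and> \<not> e 4 \<and> \<not> e 6 \<and> \<not> e 8 \<and> \<not> e 9 \<and> (e 3 \<or> e 5 \<or> e 7)"
proof -
  have s1: "b 1 \<longleftrightarrow> b 0 \<noteq> e 0" using step[of 0] by simp
  have s2: "b 2 \<longleftrightarrow> b 1 \<noteq> e 1" using step[of 1] by (simp add: numeral_2_eq_2)
  have s3: "b 3 \<longleftrightarrow> b 2 \<noteq> e 2" using step[of 2] by simp
  have s4: "b 4 \<longleftrightarrow> b 3 \<noteq> e 3" using step[of 3] by simp
  have s5: "b 5 \<longleftrightarrow> b 4 \<noteq> e 4" using step[of 4] by simp
  have s6: "b 6 \<longleftrightarrow> b 5 \<noteq> e 5" using step[of 5] by simp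
  have s7: "b 7 \<longleftrightarrow> b 6 \<noteq> e 6" using step[of 6] by simp
  have s8: "b 8 \<longleftrightarrow> b 7 \<noteq> e 7" using step[of 7] by simp
  have s9: "b 9 \<longleftrightarrow> b 8 \<noteq> e 8" using step[of 8] by simp
  have s10: "b 10 \<longleftrightarrow> b 9 \<noteq> e 9" using step[of 9] by simp
  have n1: "\<not> (e 0 \<and> e 1)" using nadj[of 0] by simp
  have n2: "\<not> (e 1 \<and> e 2)" using nadj[of 1] by (simp add: numeral_2_eq_2)
  have n3: "\<not> (e 2 \<and> e 3)" using nadj[of 2] by simp
  have n4: "\<not> (e 3 \<and> e 4)" using nadj[of 3] by simp
  have n5: "\<not> (e 4 \<and> e 5)" using nadj[of 4] by simp
  have n6: "\<not> (e 5 \<and> e 6)" using nadj[of 5] by simp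
  have n7: "\<not> (e 6 \<and> e 7)" using nadj[of 6] by simp
  have n8: "\<not> (e 7 \<and> e 8)" using nadj[of 7] by simp
  have n9: "\<not> (e 8 \<and> e 9)" using nadj[of 8] by simp
  have n10: "\<not> (e 9 \<and> e 10)" using nadj[of 9] by simp
  have u1: "b 0 \<longleftrightarrow> odd i" using up[OF e0] by simp
  have u2: "e 1 \<Longrightarrow> b 1 \<longleftrightarrow> even i" using up[of 1] by simp
  have u3: "e 2 \<Longrightarrow> b 2 \<longleftrightarrow> odd i" using up[of 2] by simp
  have u4: "e 3 \<Longrightarrow> b 3 \<longleftrightarrow> even i" using up[of 3] by simp
  have u5: "e 4 \<Longrightarrow> b 4 \<longleftrightarrow> odd i" using up[of 4] by simp
  have u6: "e 5 \<Longrightarrow> b 5 \<longleftrightarrow> even i" using up[of 5] by simp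
  have u7: "e 6 \<Longrightarrow> b 6 \<longleftrightarrow> odd i" using up[of 6] by simp
  have u8: "e 7 \<Longrightarrow> b 7 \<longleftrightarrow> even i" using up[of 7] by simp
  have u9: "e 8 \<Longrightarrow> b 8 \<longleftrightarrow> odd i" using up[of 8] by simp
  have u10: "e 9 \<Longrightarrow> b 9 \<longleftrightarrow> even i" using up[of 9] by simp
  have 1: "\<not> e 1" "b 2 \<longleftrightarrow> even i" using s1 s2 n1 u1 e0 by simp_all
  then have 2: "\<not> e 2" "b 3 \<longleftrightarrow> even i" using s3 u3 by auto
  have 9: "\<not> e 9" using n10 per e0 by simp
  show ?thesis
  \<comment> \<open>The next use is looked for at positions 3 and 5. If it is at neither, the return
    to the initial state forces a use at 7.\<close>
  proof (cases "e 3")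
    case True
    then have 4: "\<not> e 4" "b 5 \<longleftrightarrow> odd i" using 2 s4 s5 n4 by auto
    then have 5: "\<not> e 5" "b 6 \<longleftrightarrow> odd i" using s6 u6 by auto
    have 6: "\<not> e 6"
    proof
      assume "e 6"
      then have "\<not> e 7" "b 8 \<longleftrightarrow> even i" using 5 s7 s8 n7 by auto
      then have "\<not> e 8" "b 9 \<longleftrightarrow> even i" using s9 u9 by auto
      then show False using 9 s10 per u1 by auto
    qed
    then have "b 7 \<longleftrightarrow> odd i" using 5 s7 by auto
    then have 7: "\<not> e 7" "b 8 \<longleftrightarrow> odd i" using s8 u8 by auto
    have "\<not> e 8" using 7 9 s9 s10 per u1 by auto
    with 1 2 4 6 9 True show ?thesis by blast
  next
    case False
    then have 3: "b 4 \<longleftrightarrow> even i" using 2 s4 by auto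
    then have 4: "\<not> e 4" "b 5 \<longleftrightarrow> even i" using s5 u5 by auto
    show ?thesis
    proof (cases "e 5")
      case True
      then have 6: "\<not> e 6" "b 7 \<longleftrightarrow> odd i" using 4 s6 s7 n6 by auto
      then have 7: "\<not> e 7" "b 8 \<longleftrightarrow> odd i" using s8 u8 by auto
      have "\<not> e 8" using 7 9 s9 s10 per u1 by auto
      with 1 2 4 6 9 True show ?thesis by blast
    next
      case False
      then have "b 6 \<longleftrightarrow> even i" using 4 s6 by auto
      then have 6: "\<not> e 6" "b 7 \<longleftrightarrow> even i" using s7 u7 by auto
      have 7: "e 7"
      proof (rule ccontr)
        assume "\<not> e 7"
        then have "b 8 \<longleftrightarrow> even i" using 6 s8 by auto
        then have "\<not> e 8" "b 9 \<longleftrightarrow> even i" using s9 u9 by auto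
        then show False using 9 s10 per u1 by auto
      qed
      with 1 2 4 6 9 n8 show ?thesis by blast
    qed
  qed
qed

text \<open>The six sets are the two middle layers of the 3-cube above \<open>S\<close>. Only
  vertices are mentioned, as the basis conditions used later restrict vertices.\<close>

definition hexagon_free :: "'a set set \<Rightarrow> bool" where
  "hexagon_free \<V> \<longleftrightarrow> (\<forall>S a b c. distinct [a, b, c] \<longrightarrow> {a, b, c} \<inter> S = {} \<longrightarrow>
     \<not> {insert a S, insert b S, insert c S,
         insert a (insert b S), insert b (insert c S), insert a (insert c S)} \<subseteq> \<V>)"

lemma hexagon_freeD:
  assumes "hexagon_free \<V>" "distinct [a, b, c]" "{a, b, c} \<inter> S = {}"
  shows "\<not> {insert a S, insert b S, insert c S,
    insert a (insert b S), insert b (insert c S), insert a (insert c S)} \<subseteq> \<V>"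
  using assms unfolding hexagon_free_def by presburger

text \<open>\<open>X\<close> runs periodically around the cycle and \<open>d j\<close> is the
  direction of step \<open>j\<close>. By \<open>up\<close>, even steps insert and odd steps delete,
  so the walk stays in two layers and starts in the lower one. The proof extracts the chord diagram
  and verifies the conditions of \<open>no_compatible_ordering\<close>.\<close>

lemma no_ten_cycle:
  fixes X :: "nat \<Rightarrow> nat set" and d :: "nat \<Rightarrow> nat"
  assumes per: "\<And>j. X (j + 10) = X j"
    and inj: "\<And>j. X (Suc (Suc j)) \<noteq> X j"
    and fin: "\<And>j. finite (X j)"
    and up: "\<And>j. d j \<in> X j \<longleftrightarrow> odd j"
    and step: "\<And>j x. x \<in> X (Suc j) \<longleftrightarrow> (x \<in> X j) \<noteq> (x = d j)"
    and par: "\<And>j. odd (card {a \<in> X j. a < d j}) = t"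
    and hexf: "hexagon_free (range X)"
  shows False
proof -
  have dper: "d (j + 10) = d j" for j
  proof -
    have "X (Suc (j + 10)) = X (Suc j)" using per[of "Suc j"] by simp
    then show ?thesis using step[of "d j" j] step[of "d j" "j + 10"] per[of j] by auto
  qed
  have nadj: "d j \<noteq> d (Suc j)" for j
  proof
    assume "d j = d (Suc j)"
    then have "X (Suc (Suc j)) = X j" using step by auto
    then show False using inj by blast
  qed
  have mt: "d (i + 2) \<noteq> d i \<and> d (i + 4) \<noteq> d i \<and> d (i + 6) \<noteq> d i \<and> d (i + 8) \<noteq> d i
     \<and> (d (i + 3) = d i \<or> d (i + 5) = d i \<or> d (i + 7) = d i)" for i
  proof -
    have u: "d (i + k) = d i \<Longrightarrow> d i \<in> X (i + k) \<longleftrightarrow> odd (i + k)" for k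
      using up[of "i + k"] by simp
    have n: "\<not> (d (i + k) = d i \<and> d (i + Suc k) = d i)" for k
      using nadj[of "i + k"] by auto
    have st: "d i \<in> X (i + Suc k) \<longleftrightarrow> (d i \<in> X (i + k)) \<noteq> (d (i + k) = d i)" for k
      using step[of "d i" "i + k"] by auto
    show ?thesis
      using ten_cycle_matching_aux[of "\<lambda>k. d i \<in> X (i + k)" "\<lambda>k. d (i + k) = d i" i,
          OF st _ _ u n] per dper by simp
  qed
  \<comment> \<open>A step changes this parity exactly when its direction is smaller than
    \<open>x\<close>, so \<open>P\<close> records the parity of the smaller directions
    passed.\<close>
  define P where "P x j \<longleftrightarrow> odd (card {a \<in> X j. a < x})" for x j
  have Pstep: "P x (Suc j) \<longleftrightarrow> P x j \<noteq> (d j < x)" for x j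
  proof (cases "d j < x")
    case False
    then have "{a \<in> X (Suc j). a < x} = {a \<in> X j. a < x}" using step by auto
    then show ?thesis using False by (simp add: P_def)
  next
    case True
    show ?thesis
    proof (cases "d j \<in> X j")
      case in_j: True
      then have "{a \<in> X j. a < x} = insert (d j) {a \<in> X (Suc j). a < x}" "d j \<notin> {a \<in> X (Suc j). a < x}"
        using step True by auto
      then have "card {a \<in> X j. a < x} = Suc (card {a \<in> X (Suc j). a < x})"
        using fin[of "Suc j"] by simp
      then show ?thesis using True by (simp add: P_def)
    next
      case nin_j: False
      then have "{a \<in> X (Suc j). a < x} = insert (d j) {a \<in> X j. a < x}" "d j \<notin> {a \<in> X j. a < x}"
        using step True by auto
      then have "card {a \<in> X (Suc j). a < x} = Suc (card {a \<in> X j. a < x})"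
        using fin[of j] by simp
      then show ?thesis using True by (simp add: P_def)
    qed
  qed
  have Pd: "P (d j) j \<longleftrightarrow> t" for j using par by (simp add: P_def)
  \<comment> \<open>At both uses of the direction the parity is \<open>t\<close>, and the use itself
    does not change it. Hence evenly many smaller directions lie strictly between.\<close>
  have g3: "d (i + 1) < d i \<longleftrightarrow> d (i + 2) < d i" if "d i = d (i + 3)" for i
  proof -
    have s: "P (d i) (i + 1) = P (d i) i" "P (d i) (i + 2) \<longleftrightarrow> P (d i) (i + 1) \<noteq> (d (i + 1) < d i)"
      "P (d i) (i + 3) \<longleftrightarrow> P (d i) (i + 2) \<noteq> (d (i + 2) < d i)"
      using Pstep[of "d i" i] Pstep[of "d i" "i + 1"] Pstep[of "d i" "i + 2"]
      by (simp_all add: eval_nat_numeral)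
    show ?thesis using s Pd[of i] Pd[of "i + 3"] that by auto
  qed
  have g5: "(d (i + 1) < d i \<longleftrightarrow> d (i + 2) < d i) \<longleftrightarrow> (d (i + 3) < d i \<longleftrightarrow> d (i + 4) < d i)"
    if "d i = d (i + 5)" for i
  proof -
    have s: "P (d i) (i + 1) = P (d i) i" "P (d i) (i + 2) \<longleftrightarrow> P (d i) (i + 1) \<noteq> (d (i + 1) < d i)"
      "P (d i) (i + 3) \<longleftrightarrow> P (d i) (i + 2) \<noteq> (d (i + 2) < d i)"
      "P (d i) (i + 4) \<longleftrightarrow> P (d i) (i + 3) \<noteq> (d (i + 3) < d i)"
      "P (d i) (i + 5) \<longleftrightarrow> P (d i) (i + 4) \<noteq> (d (i + 4) < d i)"
      using Pstep[of "d i" i] Pstep[of "d i" "i + 1"] Pstep[of "d i" "i + 2"]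
        Pstep[of "d i" "i + 3"] Pstep[of "d i" "i + 4"]
      by (simp_all add: eval_nat_numeral)
    show ?thesis using s Pd[of i] Pd[of "i + 5"] that
      by (cases "d (i + 1) < d i"; cases "d (i + 2) < d i"; cases "d (i + 3) < d i") auto
  qed
  have hex: "\<not> (d i = d (i + 3) \<and> d (i + 1) = d (i + 4))" for i
  proof
    assume eq: "d i = d (i + 3) \<and> d (i + 1) = d (i + 4)"
    define a b c where "a = d i" and "b = d (i + 1)" and "c = d (i + 2)"
    have ne: "a \<noteq> b" "b \<noteq> c" "a \<noteq> c"
      using nadj[of i] nadj[of "i + 1"] mt[of i] by (auto simp: a_def b_def c_def)
    \<comment> \<open>The steps \<open>a\<close>, \<open>b\<close>, \<open>c\<close>,
      \<open>a\<close>, \<open>b\<close> visit six vertices that agree outside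
      \<open>{a, b, c}\<close>; \<open>S\<close> is their common part.\<close>
    define S where "S = X i - {a, b, c}"
    define Y1 Y2 Y3 Y4 Y5 where "Y1 = X (i + 1)" and "Y2 = X (i + 2)" and "Y3 = X (i + 3)"
      and "Y4 = X (i + 4)" and "Y5 = X (i + 5)"
    note Y = this
    have st: "x \<in> Y1 \<longleftrightarrow> (x \<in> X i) \<noteq> (x = a)" "x \<in> Y2 \<longleftrightarrow> (x \<in> Y1) \<noteq> (x = b)"
      "x \<in> Y3 \<longleftrightarrow> (x \<in> Y2) \<noteq> (x = c)" "x \<in> Y4 \<longleftrightarrow> (x \<in> Y3) \<noteq> (x = a)"
      "x \<in> Y5 \<longleftrightarrow> (x \<in> Y4) \<noteq> (x = b)" for x
      using step[of x i] step[of x "i + 1"] step[of x "i + 2"] step[of x "i + 3"] step[of x "i + 4"] eq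
      unfolding a_def b_def c_def Y by (simp_all add: eval_nat_numeral)
    have mem: "a \<in> X i \<longleftrightarrow> odd i" "b \<in> X i \<longleftrightarrow> even i" "c \<in> X i \<longleftrightarrow> odd i"
      using up[of i] up[of "i + 1"] up[of "i + 2"] st(1)[of b] st(1)[of c] st(2)[of c] ne
      unfolding a_def b_def c_def Y by auto
    have "{insert a S, insert b S, insert c S,
         insert a (insert b S), insert b (insert c S), insert a (insert c S)} \<subseteq> range X"
    \<comment> \<open>The parity of \<open>i\<close> decides whether \<open>X i\<close> is in the
      upper or the lower layer, hence at which vertex the walk enters the hexagon.\<close>
    proof (cases "odd i")
      case True
      have "insert a (insert c S) = X i" "insert c S = Y1" "insert b (insert c S) = Y2"
        "insert b S = Y3" "insert a (insert b S) = Y4" "insert a S = Y5"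
        using ne mem True by (auto simp: S_def st)
      then show ?thesis unfolding Y by auto
    next
      case False
      have "insert b S = X i" "insert a (insert b S) = Y1" "insert a S = Y2"
        "insert a (insert c S) = Y3" "insert c S = Y4" "insert b (insert c S) = Y5"
        using ne mem False by (auto simp: S_def st)
      then show ?thesis unfolding Y by auto
    qed
    moreover have "distinct [a, b, c]" "{a, b, c} \<inter> S = {}" using ne by (auto simp: S_def)
    ultimately show False using hexagon_freeD[OF hexf, of a b c S] by metis
  qed
  have mt_eq: "d i = d (i + 3) \<or> d i = d (i + 5) \<or> d i = d (i + 7)"
    and mt_ne: "d i \<noteq> d (i + 2) \<and> d i \<noteq> d (i + 4) \<and> d i \<noteq> d (i + 6) \<and> d i \<noteq> d (i + 8)" for i
    using mt[of i] by metis+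
  have dp: "d 10 = d 0" "d 11 = d 1" "d 12 = d 2" "d 13 = d 3" "d 14 = d 4" "d 15 = d 5"
    using dper[of 0] dper[of 1] dper[of 2] dper[of 3] dper[of 4] dper[of 5] by simp_all
  have m0: "d 0 = d 3 \<or> d 0 = d 5 \<or> d 0 = d 7"
    using mt_eq[of 0] by (simp add: dp)
  have m2: "d 2 = d 5 \<or> d 2 = d 7 \<or> d 2 = d 9"
    using mt_eq[of 2] by (simp add: dp)
  have m4: "d 4 = d 7 \<or> d 4 = d 9 \<or> d 4 = d 1"
    using mt_eq[of 4] by (simp add: dp)
  have m6: "d 6 = d 9 \<or> d 6 = d 1 \<or> d 6 = d 3"
    using mt_eq[of 6] by (simp add: dp)
  have m8: "d 8 = d 1 \<or> d 8 = d 3 \<or> d 8 = d 5"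
    using mt_eq[of 8] by (simp add: dp)
  have dist: "distinct [d 0, d 2, d 4, d 6, d 8]"
    using mt_ne[of 0] mt_ne[of 2] mt_ne[of 4] mt_ne[of 6]
    by (simp add: numeral_2_eq_2[symmetric])
  have g3_0: "d 0 = d 3 \<Longrightarrow> d 1 < d 0 \<longleftrightarrow> d 2 < d 0"
    using g3[of 0] dp by (simp add: numeral_2_eq_2[symmetric])
  have g3_1: "d 1 = d 4 \<Longrightarrow> d 2 < d 1 \<longleftrightarrow> d 3 < d 1"
    using g3[of 1] dp by (simp add: numeral_2_eq_2[symmetric])
  have g3_2: "d 2 = d 5 \<Longrightarrow> d 3 < d 2 \<longleftrightarrow> d 4 < d 2"
    using g3[of 2] dp by simp
  have g3_3: "d 3 = d 6 \<Longrightarrow> d 4 < d 3 \<longleftrightarrow> d 5 < d 3"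
    using g3[of 3] dp by simp
  have g3_4: "d 4 = d 7 \<Longrightarrow> d 5 < d 4 \<longleftrightarrow> d 6 < d 4"
    using g3[of 4] dp by simp
  have g3_5: "d 5 = d 8 \<Longrightarrow> d 6 < d 5 \<longleftrightarrow> d 7 < d 5"
    using g3[of 5] dp by simp
  have g3_6: "d 6 = d 9 \<Longrightarrow> d 7 < d 6 \<longleftrightarrow> d 8 < d 6"
    using g3[of 6] dp by simp
  have g3_7: "d 7 = d 0 \<Longrightarrow> d 8 < d 7 \<longleftrightarrow> d 9 < d 7"
    using g3[of 7] dp by simp
  have g3_8: "d 8 = d 1 \<Longrightarrow> d 9 < d 8 \<longleftrightarrow> d 0 < d 8"
    using g3[of 8] dp by simp
  have g3_9: "d 9 = d 2 \<Longrightarrow> d 0 < d 9 \<longleftrightarrow> d 1 < d 9"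
    using g3[of 9] dp by simp
  have g5_0: "d 0 = d 5 \<Longrightarrow> (d 1 < d 0 \<longleftrightarrow> d 2 < d 0) \<longleftrightarrow> (d 3 < d 0 \<longleftrightarrow> d 4 < d 0)"
    using g5[of 0] dp by (simp add: numeral_2_eq_2[symmetric])
  have g5_1: "d 1 = d 6 \<Longrightarrow> (d 2 < d 1 \<longleftrightarrow> d 3 < d 1) \<longleftrightarrow> (d 4 < d 1 \<longleftrightarrow> d 5 < d 1)"
    using g5[of 1] dp by (simp add: numeral_2_eq_2[symmetric])
  have g5_2: "d 2 = d 7 \<Longrightarrow> (d 3 < d 2 \<longleftrightarrow> d 4 < d 2) \<longleftrightarrow> (d 5 < d 2 \<longleftrightarrow> d 6 < d 2)"
    using g5[of 2] dp by simp
  have g5_3: "d 3 = d 8 \<Longrightarrow> (d 4 < d 3 \<longleftrightarrow> d 5 < d 3) \<longleftrightarrow> (d 6 < d 3 \<longleftrightarrow> d 7 < d 3)"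
    using g5[of 3] dp by simp
  have g5_4: "d 4 = d 9 \<Longrightarrow> (d 5 < d 4 \<longleftrightarrow> d 6 < d 4) \<longleftrightarrow> (d 7 < d 4 \<longleftrightarrow> d 8 < d 4)"
    using g5[of 4] dp by simp
  have h0: "\<not> (d 0 = d 3 \<and> d 1 = d 4)"
    using hex[of 0] dp by (simp add: numeral_2_eq_2[symmetric])
  have h1: "\<not> (d 1 = d 4 \<and> d 2 = d 5)"
    using hex[of 1] dp by (simp add: numeral_2_eq_2[symmetric])
  have h2: "\<not> (d 2 = d 5 \<and> d 3 = d 6)"
    using hex[of 2] dp by simp
  have h3: "\<not> (d 3 = d 6 \<and> d 4 = d 7)"
    using hex[of 3] dp by simp
  have h4: "\<not> (d 4 = d 7 \<and> d 5 = d 8)"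
    using hex[of 4] dp by simp
  have h5: "\<not> (d 5 = d 8 \<and> d 6 = d 9)"
    using hex[of 5] dp by simp
  have h6: "\<not> (d 6 = d 9 \<and> d 7 = d 0)"
    using hex[of 6] dp by simp
  have h7: "\<not> (d 7 = d 0 \<and> d 8 = d 1)"
    using hex[of 7] dp by simp
  have h8: "\<not> (d 8 = d 1 \<and> d 9 = d 2)"
    using hex[of 8] dp by simp
  have h9: "\<not> (d 9 = d 2 \<and> d 0 = d 3)"
    using hex[of 9] dp by simp
  show False
    by (rule no_compatible_ordering[OF m0 m2 m4 m6 m8 dist
      g3_0 g3_1 g3_2 g3_3 g3_4 g3_5 g3_6 g3_7 g3_8 g3_9
      g5_0 g5_1 g5_2 g5_3 g5_4
      h0 h1 h2 h3 h4 h5 h6 h7 h8 h9])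
qed

section \<open>Linear independence over the field with two elements\<close>

text \<open>In characteristic 2 every linear combination is a subset sum, so this is linear
  independence. Working with an indexed family makes repeated vectors dependent.\<close>

definition indep :: "('i \<Rightarrow> 'a::ab_group_add) \<Rightarrow> 'i set \<Rightarrow> bool" where
  "indep v T \<longleftrightarrow> (\<forall>U\<subseteq>T. U \<noteq> {} \<longrightarrow> sum v U \<noteq> 0)"

text \<open>In characteristic 2 this is the span of the family on \<open>T\<close>.\<close>

definition subset_sums :: "('i \<Rightarrow> 'a::ab_group_add) \<Rightarrow> 'i set \<Rightarrow> 'a set" where
  "subset_sums v T = sum v ` Pow T"

lemma indep_cong: "(\<And>i. i \<in> T \<Longrightarrow> v i = w i) \<Longrightarrow> indep v T = indep w T"
  unfolding indep_def by (metis (no_types, lifting) subsetD sum.cong)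

lemma subset_sums_cong: "(\<And>i. i \<in> T \<Longrightarrow> v i = w i) \<Longrightarrow> subset_sums v T = subset_sums w T"
  unfolding subset_sums_def by (intro image_cong refl sum.cong) auto

lemma finite_subset_sums: "finite T \<Longrightarrow> finite (subset_sums v T)"
  unfolding subset_sums_def by simp

lemma card_subset_sums_le: "finite T \<Longrightarrow> card (subset_sums v T) \<le> 2 ^ card T"
  unfolding subset_sums_def by (metis card_Pow card_image_le finite_Pow_iff)

context
  fixes v :: "'i \<Rightarrow> 'a::ab_group_add"
  assumes char_2: "\<And>x::'a. x + x = 0"
begin

lemma eq_if_sum_eq_0: "x + y = 0 \<Longrightarrow> x = (y::'a)"
  using char_2[of y] by (metis add_right_imp_eq)

lemma sum_sym_diff:
  assumes "finite T" "finite U"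
  shows "sum v T + sum v U = sum v (sym_diff T U)"
proof -
  have "sum v T = sum v (T - U) + sum v (T \<inter> U)" "sum v U = sum v (U - T) + sum v (T \<inter> U)"
    using assms by (metis add.commute sum.Int_Diff, metis Int_commute add.commute sum.Int_Diff)
  moreover have "sum v (sym_diff T U) = sum v (T - U) + sum v (U - T)"
    using assms by (intro sum.union_disjoint) auto
  ultimately show ?thesis
    using char_2[of "sum v (T \<inter> U)"] by (simp add: algebra_simps)
qed

text \<open>A vanishing sum that involves \<open>a\<close> would express \<open>v a\<close> as a
  subset sum over \<open>T\<close>.\<close>

lemma indep_insert:
  assumes "finite T" "indep v T" "v a \<notin> subset_sums v T"
  shows "indep v (insert a T)"
  unfolding indep_def
proof (intro allI impI)
  fix U assume U: "U \<subseteq> insert a T" "U \<noteq> {}"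
  show "sum v U \<noteq> 0"
  proof (cases "a \<in> U")
    case False
    then show ?thesis using U assms(2) unfolding indep_def by (metis subset_insert)
  next
    case True
    have "finite U" using U assms(1) finite_subset by blast
    then have "sum v U = v a + sum v (U - {a})" using True by (simp add: sum.remove)
    moreover have "sum v (U - {a}) \<in> subset_sums v T"
      using U unfolding subset_sums_def by auto
    ultimately show ?thesis using assms(3) eq_if_sum_eq_0 by metis
  qed
qed

text \<open>If two subsets have equal sums, the sum over their symmetric difference vanishes, so
  that difference is empty.\<close>

lemma indep_inj_on_sum:
  assumes "finite T" "indep v T"
  shows "inj_on (sum v) (Pow T)"
proof (rule inj_onI)
  fix U W assume UW: "U \<in> Pow T" "W \<in> Pow T" "sum v U = sum v W"
  have "finite U" "finite W" using UW assms(1) finite_subset by auto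
  then have "sum v (sym_diff U W) = 0"
    using sum_sym_diff[of U W] UW(3) char_2 by simp
  then have "sym_diff U W = {}"
    using assms(2) UW(1,2) unfolding indep_def by (metis PowD Un_least Diff_subset subset_trans)
  then show "U = W" by auto
qed

text \<open>The span of \<open>v\<close> on \<open>S\<close> has index 4 in \<open>V\<close>, so its cosets through 0 and
  four pairwise independent vectors do not fit into \<open>V\<close>.\<close>
lemma no_daisy:
  assumes V: "finite V" "card V = 2 ^ (card S + 2)" "0 \<in> V" "\<And>x y. x \<in> V \<Longrightarrow> y \<in> V \<Longrightarrow> x + y \<in> V"
    and fin: "finite S" "finite Q" and card_Q: "card Q = 4" and disj: "Q \<inter> S = {}"
    and vV: "\<And>i. i \<in> S \<union> Q \<Longrightarrow> v i \<in> V"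
    and ind: "\<And>p q. p \<in> Q \<Longrightarrow> q \<in> Q \<Longrightarrow> p \<noteq> q \<Longrightarrow> indep v (insert p (insert q S))"
  shows False
proof -
  \<comment> \<open>The elements of \<open>R\<close> index the five coset representatives: the empty
    sum 0 and the four single vectors.\<close>
  define R where "R = insert {} ((\<lambda>q. {q}) ` Q)"
  have sumV: "sum v T \<in> V" if "T \<subseteq> S \<union> Q" for T
    using that V(3,4) vV by (induction T rule: infinite_finite_induct) auto
  have "inj_on (\<lambda>(T, r). sum v (T \<union> r)) (Pow S \<times> R)"
  proof (rule inj_onI, clarify)
    fix T T' r r' assume T: "T \<subseteq> S" "T' \<subseteq> S" and r: "r \<in> R" "r' \<in> R"
      and eq: "sum v (T \<union> r) = sum v (T' \<union> r')"
    \<comment> \<open>Two members of \<open>R\<close> involve at most two points of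
      \<open>Q\<close>, so both sums live over one independent family on
      \<open>insert p (insert q S)\<close>.\<close>
    obtain p q where pq: "p \<in> Q" "q \<in> Q" "p \<noteq> q" "r \<subseteq> {p, q}" "r' \<subseteq> {p, q}"
    proof -
      obtain p where p: "p \<in> Q" "r \<subseteq> {p}" using r(1) card_Q unfolding R_def by fastforce
      show ?thesis
      proof (cases "r' \<subseteq> {p}")
        case False
        then obtain q where "q \<in> Q" "r' = {q}" "p \<noteq> q" using r(2) unfolding R_def by auto
        then show ?thesis using p that[of p q] by auto
      next
        case True
        have "Q - {p} \<noteq> {}"
        proof
          assume "Q - {p} = {}"
          then have "card Q \<le> card {p}" by (intro card_mono) auto
          then show False using card_Q by simp
        qed
        then show ?thesis using p True that[of p] by blast
      qed
    qed
    have "T \<union> r = T' \<union> r'"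
      using indep_inj_on_sum[OF _ ind[OF pq(1-3)]] eq T pq fin by (auto dest!: inj_onD)
    moreover have "r \<inter> S = {}" "r' \<inter> S = {}" using r disj unfolding R_def by auto
    ultimately show "T = T' \<and> r = r'" using T by blast
  qed
  moreover have "(\<lambda>(T, r). sum v (T \<union> r)) ` (Pow S \<times> R) \<subseteq> V"
    using sumV unfolding R_def by (fastforce intro!: sumV)
  ultimately have "card (Pow S \<times> R) \<le> card V"
    using V(1) card_inj_on_le by blast
  \<comment> \<open>Five disjoint cosets of size \<open>2 ^ card S\<close> would have to fit into
    only \<open>4 * 2 ^ card S\<close> vectors.\<close>
  moreover have "card R = 5"
    unfolding R_def using card_Q fin by (subst card_insert_disjoint) (auto simp: card_image)
  ultimately show False
    using V(2) fin by (simp add: card_cartesian_product card_Pow)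
qed

end


section \<open>Counting assignments of vectors\<close>

text \<open>Each \<open>f\<close> with \<open>P f\<close> extends to \<open>a\<close> in at least
  \<open>card V - k\<close> ways, since at most \<open>k\<close> values are forbidden. The
  \<open>cong\<close> assumptions say that \<open>P\<close> and \<open>B\<close> ignore the value at
  \<open>a\<close>.\<close>

lemma card_PiE_insert_ge:
  assumes V: "finite V" and I: "finite I" "a \<notin> I"
    and cong: "\<And>f y. P (f(a := y)) = P f" "\<And>f y. B (f(a := y)) = B f"
    and B: "\<And>f. finite (B f)" "\<And>f. card (B f) \<le> k"
  shows "(card V - k) * card {f \<in> PiE I (\<lambda>_. V). P f}
    \<le> card {f \<in> PiE (insert a I) (\<lambda>_. V). P f \<and> f a \<notin> B f}" (is "_ * card ?X \<le> card ?Y")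
proof -
  have fX: "finite ?X" and fY: "finite ?Y"
    using V I by (auto intro!: finite_PiE)
  have "inj_on (\<lambda>(f, y). f(a := y)) (Sigma ?X (\<lambda>f. V - B f))"
  proof (rule inj_onI, clarify)
    fix f y g z assume f: "f \<in> PiE I (\<lambda>_. V)" and g: "g \<in> PiE I (\<lambda>_. V)" and eq: "f(a := y) = g(a := z)"
    have "f = g"
    proof
      fix i show "f i = g i"
        using fun_cong[OF eq, of i] f g I(2) by (cases "i = a") (auto simp: PiE_def extensional_def)
    qed
    moreover have "y = z" using fun_cong[OF eq, of a] by simp
    ultimately show "f = g \<and> y = z" by simp
  qed
  moreover have "(\<lambda>(f, y). f(a := y)) ` (Sigma ?X (\<lambda>f. V - B f)) \<subseteq> ?Y"
  proof clarify
    fix f y assume "f \<in> PiE I (\<lambda>_. V)" "P f" "y \<in> V" "y \<notin> B f"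
    then show "f(a := y) \<in> PiE (insert a I) (\<lambda>_. V) \<and> P (f(a := y)) \<and> (f(a := y)) a \<notin> B (f(a := y))"
      by (simp only: cong PiE_fun_upd fun_upd_same simp_thms)
  qed
  ultimately have "card (Sigma ?X (\<lambda>f. V - B f)) \<le> card ?Y"
    using card_inj_on_le fY by blast
  moreover have "card (Sigma ?X (\<lambda>f. V - B f)) = (\<Sum>f\<in>?X. card (V - B f))"
    using fX V by (intro card_SigmaI) auto
  moreover have "(\<Sum>f\<in>?X. card V - k) \<le> (\<Sum>f\<in>?X. card (V - B f))"
  proof (rule sum_mono)
    fix f assume "f \<in> ?X"
    have "card (V \<inter> B f) \<le> k"
      using B[of f] card_mono[of "B f" "V \<inter> B f"] by auto
    moreover have "card (V - B f) = card V - card (V \<inter> B f)"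
      using V by (simp add: card_Diff_subset_Int)
    ultimately show "card V - k \<le> card (V - B f)" by simp
  qed
  ultimately show ?thesis by (simp add: mult.commute)
qed

text \<open>An \<open>r\<close>-dimensional space over the field with two elements, realised inside
  one type so that \<open>r\<close> can vary from layer to layer.\<close>

definition cube_vectors :: "nat \<Rightarrow> (nat \<Rightarrow> bit) set" where
  "cube_vectors r = {f. \<forall>i\<ge>r. f i = 0}"

lemma bit_fun_char_2: "x + x = (0 :: nat \<Rightarrow> bit)"
  by (rule ext) simp

lemma card_cube_vectors: "finite (cube_vectors r)" "card (cube_vectors r) = 2 ^ r"
proof -
  have "bij_betw (\<lambda>S i. of_bool (i \<in> S)) (Pow {..<r}) (cube_vectors r)"
    by (rule bij_betw_byWitness[where f' = "\<lambda>f. {i. f i = 1}"])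
      (auto simp: cube_vectors_def fun_eq_iff not_le intro: ccontr)
  then show "finite (cube_vectors r)" "card (cube_vectors r) = 2 ^ r"
    by (auto simp: bij_betw_same_card[symmetric] card_Pow dest: bij_betw_finite)
qed

text \<open>The vectors are chosen one at a time; after \<open>j\<close> choices at most
  \<open>2 ^ j\<close> vectors lie in the span and are excluded.\<close>

lemma card_indep_ge:
  assumes "finite A"
  shows "(\<Prod>j<card A. 2 ^ r - 2 ^ j) \<le> card {v \<in> PiE A (\<lambda>_. cube_vectors r). indep v A}"
  using assms
proof (induction A rule: finite_induct)
  case empty
  then show ?case by (simp add: indep_def)
next
  case (insert a A)
  let ?V = "cube_vectors r"
  have "(\<Prod>j<card (insert a A). 2 ^ r - 2 ^ j) = (2 ^ r - 2 ^ card A) * (\<Prod>j<card A. 2 ^ r - 2 ^ j :: nat)"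
    using insert by simp
  also have "\<dots> \<le> (card ?V - 2 ^ card A) * card {v \<in> PiE A (\<lambda>_. ?V). indep v A}"
    using insert by (simp add: card_cube_vectors)
  also have "\<dots> \<le> card {v \<in> PiE (insert a A) (\<lambda>_. ?V). indep v A \<and> v a \<notin> subset_sums v A}"
    using insert
    by (intro card_PiE_insert_ge card_cube_vectors card_subset_sums_le finite_subset_sums indep_cong subset_sums_cong) auto
  also have "\<dots> \<le> card {v \<in> PiE (insert a A) (\<lambda>_. ?V). indep v (insert a A)}"
    using insert by (intro card_mono finite_subset[OF _ finite_PiE[of "insert a A" "\<lambda>_. ?V"]])
      (auto intro: indep_insert[OF bit_fun_char_2] simp: card_cube_vectors)
  finally show ?case .
qed

text \<open>The coordinates in \<open>J\<close> are free and each contributes a factor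
  \<open>card V\<close>.\<close>

lemma card_PiE_Un_ge:
  assumes V: "finite V" and "finite J" "finite I" "I \<inter> J = {}"
    and cong: "\<And>f a y. a \<in> J \<Longrightarrow> P (f(a := y)) = P f"
  shows "card V ^ card J * card {f \<in> PiE I (\<lambda>_. V). P f} \<le> card {f \<in> PiE (I \<union> J) (\<lambda>_. V). P f}"
  using assms(2-)
proof (induction J rule: finite_induct)
  case empty
  then show ?case by simp
next
  case (insert a J)
  have "card V ^ card (insert a J) * card {f \<in> PiE I (\<lambda>_. V). P f}
      = (card V - 0) * (card V ^ card J * card {f \<in> PiE I (\<lambda>_. V). P f})"
    using insert by simp
  also have "\<dots> \<le> (card V - 0) * card {f \<in> PiE (I \<union> J) (\<lambda>_. V). P f}"
    using insert by (intro mult_le_mono2 insert.IH) auto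
  also have "\<dots> \<le> card {f \<in> PiE (insert a (I \<union> J)) (\<lambda>_. V). P f \<and> f a \<notin> {}}"
    using insert.hyps insert.prems(1,2) V by (intro card_PiE_insert_ge insert.prems(3)) auto
  finally show ?case by simp
qed

text \<open>First independent vectors are placed on \<open>A\<close>. Their span is half of
  \<open>V\<close>, so the vectors at \<open>x\<close> and at \<open>n\<close> each avoid it with
  probability 1/2, and all other coordinates are free.\<close>

lemma card_indep_pair_ge:
  fixes n :: nat
  assumes A: "A \<subseteq> {..<n}" "x < n" "x \<notin> A"
  defines "V \<equiv> cube_vectors (Suc (card A))"
  shows "(\<Prod>k\<le>card A. 1 - 1 / 2 ^ (k + 1)) / 2 * real (card (PiE {..n} (\<lambda>_. V)))
    \<le> real (card {v \<in> PiE {..n} (\<lambda>_. V). indep v (insert x A) \<and> indep v (insert n A)})"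
proof -
  let ?s = "card A" and ?N = "2 ^ Suc (card A) :: real"
  have fA: "finite A" using A(1) finite_lessThan by (rule finite_subset)
  have V: "finite V" "card V = 2 ^ Suc ?s" unfolding V_def by (rule card_cube_vectors)+
  define J where "J = {..n} - insert n (insert x A)"
  have nA: "n \<notin> insert x A" using A by auto
  have un: "insert n (insert x A) \<union> J = {..n}" using A by (auto simp: J_def)
  have "card (insert n (insert x A)) = ?s + 2" using nA A(3) fA by simp
  then have cJ: "?s + 2 + card J = Suc n"
    using card_Un_disjoint[of "insert n (insert x A)" J] fA un by (simp add: J_def)
  let ?X0 = "{v \<in> PiE A (\<lambda>_. V). indep v A}"
  let ?X1 = "{v \<in> PiE (insert x A) (\<lambda>_. V). indep v A \<and> v x \<notin> subset_sums v A}"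
  let ?P2 = "\<lambda>v. (indep v A \<and> v x \<notin> subset_sums v A) \<and> v n \<notin> subset_sums v A"
  let ?X2 = "{v \<in> PiE (insert n (insert x A)) (\<lambda>_. V). ?P2 v}"
  let ?X3 = "{v \<in> PiE (insert n (insert x A) \<union> J) (\<lambda>_. V). ?P2 v}"
  have ic1: "indep (f(a := y)) A = indep f A" if "a \<notin> A" for f a and y :: "nat \<Rightarrow> bit"
    by (rule indep_cong) (use that in auto)
  have ic2: "subset_sums (f(a := y)) A = subset_sums f A" if "a \<notin> A" for f a and y :: "nat \<Rightarrow> bit"
    by (rule subset_sums_cong) (use that in auto)
  have half: "card V - 2 ^ ?s = 2 ^ ?s" by (simp add: V)
  have "(card V - 2 ^ ?s) * card ?X0 \<le> card ?X1"
    using fA A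
    by (intro card_PiE_insert_ge[where P = "\<lambda>v. indep v A" and B = "\<lambda>v. subset_sums v A"]
        V card_subset_sums_le finite_subset_sums ic1 ic2) auto
  then have X1: "2 ^ ?s * card ?X0 \<le> card ?X1"
    unfolding half .
  have "(card V - 2 ^ ?s) * card ?X1 \<le> card ?X2"
    using fA A nA
    by (intro card_PiE_insert_ge[where P = "\<lambda>v. indep v A \<and> v x \<notin> subset_sums v A"
          and B = "\<lambda>v. subset_sums v A"]
        V card_subset_sums_le finite_subset_sums) (auto simp: ic1 ic2)
  then have X2: "2 ^ ?s * card ?X1 \<le> card ?X2"
    unfolding half .
  have X3: "card V ^ card J * card ?X2 \<le> card ?X3"
    using fA by (intro card_PiE_Un_ge V) (auto simp: J_def ic1 ic2)
  have "?X3 \<subseteq> {v \<in> PiE {..n} (\<lambda>_. V). indep v (insert x A) \<and> indep v (insert n A)}"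
    unfolding un using fA by (auto intro: indep_insert[OF bit_fun_char_2])
  then have X4: "card ?X3 \<le> card {v \<in> PiE {..n} (\<lambda>_. V). indep v (insert x A) \<and> indep v (insert n A)}"
    using V by (intro card_mono) (auto intro!: finite_PiE)
  have X0: "(\<Prod>j<?s. 2 ^ Suc ?s - 2 ^ j) \<le> card ?X0"
    unfolding V_def by (rule card_indep_ge[OF fA])
  have "card V ^ card J * (2 ^ ?s * (2 ^ ?s * (\<Prod>j<?s. 2 ^ Suc ?s - 2 ^ j)))
      \<le> card V ^ card J * (2 ^ ?s * (2 ^ ?s * card ?X0))"
    using X0 by (intro mult_le_mono2)
  also have "\<dots> \<le> card V ^ card J * (2 ^ ?s * card ?X1)" using X1 by (intro mult_le_mono2)
  also have "\<dots> \<le> card V ^ card J * card ?X2" using X2 by (intro mult_le_mono2)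
  also note X3
  also note X4
  finally have main: "card V ^ card J * (2 ^ ?s * (2 ^ ?s * (\<Prod>j<?s. 2 ^ Suc ?s - 2 ^ j)))
    \<le> card {v \<in> PiE {..n} (\<lambda>_. V). indep v (insert x A) \<and> indep v (insert n A)}" .
  have "real (\<Prod>j<?s. 2 ^ Suc ?s - 2 ^ j) = (\<Prod>j<?s. ?N - 2 ^ j)"
    unfolding of_nat_prod
  proof (intro prod.cong refl)
    fix j assume "j \<in> {..<?s}"
    then have "(2::nat) ^ j \<le> 2 ^ Suc ?s" by (intro power_increasing) auto
    then show "real (2 ^ Suc ?s - 2 ^ j) = ?N - 2 ^ j" by (simp only: of_nat_diff of_nat_power of_nat_numeral)
  qed
  \<comment> \<open>The exponent is \<open>Suc ?s - j\<close>, written so that reversing the order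
    of the factors turns it into \<open>j + 2\<close>.\<close>
  also have "\<dots> = (\<Prod>j<?s. ?N * (1 - 1 / 2 ^ (?s - Suc j + 2)))"
  proof (intro prod.cong refl)
    fix j assume "j \<in> {..<?s}"
    then have "Suc ?s = j + (?s - Suc j + 2)" by simp
    then have "?N = 2 ^ j * 2 ^ (?s - Suc j + 2)" by (metis power_add)
    then show "?N - 2 ^ j = ?N * (1 - 1 / 2 ^ (?s - Suc j + 2))" by (simp add: algebra_simps)
  qed
  also have "\<dots> = ?N ^ ?s * (\<Prod>j<?s. 1 - 1 / 2 ^ (?s - Suc j + 2))"
    by (simp add: prod.distrib)
  also have "(\<Prod>j<?s. 1 - 1 / 2 ^ (?s - Suc j + 2) :: real) = (\<Prod>j<?s. 1 - 1 / 2 ^ (j + 2))"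
    by (rule prod.nat_diff_reindex[of "\<lambda>j. 1 - 1 / 2 ^ (j + 2)"])
  \<comment> \<open>The product starts with the denominator 4; supplying the missing factor 1/2 at
    \<open>k = 0\<close> costs the factor 2.\<close>
  also have "\<dots> = 2 * (\<Prod>k\<le>?s. 1 - 1 / 2 ^ (k + 1))"
    unfolding lessThan_Suc_atMost[symmetric] prod.lessThan_Suc_shift by simp
  finally have pr: "real (\<Prod>j<?s. 2 ^ Suc ?s - 2 ^ j) = ?N ^ ?s * (2 * (\<Prod>k\<le>?s. 1 - 1 / 2 ^ (k + 1)))" .
  have "real (card (PiE {..n} (\<lambda>_. V))) = ?N ^ (card J + ?s + 2)"
    using V cJ by (simp add: card_PiE add.commute add.left_commute)
  then have "(\<Prod>k\<le>?s. 1 - 1 / 2 ^ (k + 1)) / 2 * real (card (PiE {..n} (\<lambda>_. V)))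
    = ?N ^ card J * (2 ^ ?s * (2 ^ ?s * (?N ^ ?s * (2 * (\<Prod>k\<le>?s. 1 - 1 / 2 ^ (k + 1))))))"
    by (simp add: power_add power2_eq_square)
  also have "\<dots> = real (card V ^ card J * (2 ^ ?s * (2 ^ ?s * (\<Prod>j<?s. 2 ^ Suc ?s - 2 ^ j))))"
    unfolding of_nat_mult pr by (simp add: V)
  finally show ?thesis using main by linarith
qed

section \<open>Bounds for the infinite product\<close>

lemma one_minus_half_power_bounds: "0 \<le> (1 - 1 / 2 ^ (k + 1) :: real)" "(1 - 1 / 2 ^ (k + 1) :: real) \<le> 1"
  using one_le_power[of "2::real" "k + 1"] by (simp_all add: field_simps)

text \<open>All factors lie between 0 and 1, so the partial products decrease to their
  limit.\<close>

lemma prodinf_half_powers_le: "(\<Prod>k. 1 - 1 / 2 ^ (k + 1)) \<le> (\<Prod>k\<le>s. 1 - 1 / 2 ^ (k + 1) :: real)"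
proof (rule decseq_ge)
  show "(\<lambda>s. \<Prod>k\<le>s. 1 - 1 / 2 ^ (k + 1) :: real) \<longlonglongrightarrow> (\<Prod>k. 1 - 1 / 2 ^ (k + 1))"
    by (rule convergent_prod_LIMSEQ[OF convergent_prod_one_minus_half_powers])
  show "decseq (\<lambda>s. \<Prod>k\<le>s. 1 - 1 / 2 ^ (k + 1) :: real)"
    unfolding prod.atMost_Suc
    by (intro decseq_SucI) (simp only: prod.atMost_Suc mult_left_le one_minus_half_power_bounds prod_nonneg)
qed

text \<open>A convergent product without zero factors is nonzero, and a limit of nonnegative partial
  products is nonnegative.\<close>

lemma prodinf_half_powers_pos: "0 < (\<Prod>k. 1 - 1 / 2 ^ (k + 1) :: real)"
proof -
  have "0 \<le> (\<Prod>k. 1 - 1 / 2 ^ (k + 1) :: real)"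
    by (rule LIMSEQ_le_const[OF convergent_prod_LIMSEQ[OF convergent_prod_one_minus_half_powers]])
      (simp only: one_minus_half_power_bounds prod_nonneg simp_thms)
  moreover have "(\<Prod>k. 1 - 1 / 2 ^ (k + 1) :: real) \<noteq> 0"
  proof (rule prodinf_nonzero[OF convergent_prod_one_minus_half_powers])
    show "1 - 1 / 2 ^ (k + 1) \<noteq> (0::real)" for k
      using one_less_power[of "2::real" "k + 1"] by (simp add: field_simps)
  qed
  ultimately show ?thesis by linarith
qed

text \<open>Averaging: each pair in \<open>E\<close> is good for at least the stated fraction of all
  assignments, so some assignment makes at least this fraction of the pairs good.\<close>

lemma exists_dense_indep:
  fixes n :: nat
  assumes E: "finite E" "\<And>A x. (A, x) \<in> E \<Longrightarrow> A \<subseteq> {..<n} \<and> x < n \<and> x \<notin> A \<and> card A = s"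
  shows "\<exists>v \<in> {..n} \<rightarrow> cube_vectors (Suc s).
    (\<Prod>k. 1 - 1 / 2 ^ (k + 1)) / 2 * real (card E)
      \<le> card {(A, x) \<in> E. indep v (insert x A) \<and> indep v (insert n A)}"
proof (rule ccontr)
  let ?\<Omega> = "PiE {..n} (\<lambda>_. cube_vectors (Suc s))" and ?c = "(\<Prod>k. 1 - 1 / 2 ^ (k + 1) :: real)"
  define G where "G v e \<longleftrightarrow> (case e of (A, x) \<Rightarrow> indep v (insert x A) \<and> indep v (insert n A))"
    for v :: "nat \<Rightarrow> nat \<Rightarrow> bit" and e
  assume *: "\<not> ?thesis"
  have neg: "real (card {e \<in> E. G v e}) < ?c / 2 * real (card E)"
    if "v \<in> {..n} \<rightarrow> cube_vectors (Suc s)" for v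
  proof -
    have eq: "{e \<in> E. G v e} = {(A, x) \<in> E. indep v (insert x A) \<and> indep v (insert n A)}"
      by (auto simp: G_def)
    have "\<not> ?c / 2 * real (card E) \<le> real (card {(A, x) \<in> E. indep v (insert x A) \<and> indep v (insert n A)})"
      by (rule notI, rule notE[OF *], rule bexI[OF _ that])
    then show ?thesis unfolding eq by (simp only: not_le)
  qed
  have fin: "finite ?\<Omega>"
    using card_cube_vectors(1) by (intro finite_PiE) auto
  have "cube_vectors (Suc s) \<noteq> {}"
    using card_cube_vectors(2)[of "Suc s"] by force
  then have ne: "?\<Omega> \<noteq> {}"
    by (simp add: PiE_eq_empty_iff)
  have "(\<Sum>v\<in>?\<Omega>. real (card {e \<in> E. G v e})) < (\<Sum>v\<in>?\<Omega>. ?c / 2 * real (card E))"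
    using fin ne by (intro sum_strict_mono neg) (auto simp: PiE_def)
  also have "\<dots> = (\<Sum>e\<in>E. ?c / 2 * real (card ?\<Omega>))"
    by simp
  also have "\<dots> \<le> (\<Sum>e\<in>E. real (card {v \<in> ?\<Omega>. G v e}))"
  proof (rule sum_mono)
    fix e assume e: "e \<in> E"
    obtain A x where Ax: "e = (A, x)" by (cases e)
    have "?c / 2 * real (card ?\<Omega>) \<le> (\<Prod>k\<le>s. 1 - 1 / 2 ^ (k + 1)) / 2 * real (card ?\<Omega>)"
      by (intro mult_right_mono divide_right_mono prodinf_half_powers_le) auto
    also have "\<dots> \<le> real (card {v \<in> ?\<Omega>. G v e})"
      using card_indep_pair_ge[of A n x] E(2)[of A x] e unfolding Ax G_def prod.case by blast
    finally show "?c / 2 * real (card ?\<Omega>) \<le> real (card {v \<in> ?\<Omega>. G v e})" .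
  qed
  also have "\<dots> = (\<Sum>e\<in>E. \<Sum>v\<in>?\<Omega>. of_bool (G v e))"
    using fin by (simp add: sum_of_bool_eq Collect_conj_eq)
  \<comment> \<open>Double counting of the good incidences between assignments and pairs.\<close>
  also have "\<dots> = (\<Sum>v\<in>?\<Omega>. \<Sum>e\<in>E. of_bool (G v e))"
    by (rule sum.swap)
  also have "\<dots> = (\<Sum>v\<in>?\<Omega>. real (card {e \<in> E. G v e}))"
    using E(1) by (simp add: sum_of_bool_eq Collect_conj_eq)
  finally show False by simp
qed

section \<open>Subgraphs of the hypercube\<close>

text \<open>The point \<open>n\<close> acts as a fourth petal: lower vertices of a hexagon yield the
  pairs with \<open>n\<close>, upper vertices the pairs inside \<open>{a, b, c}\<close>. All six
  pairs are then independent over \<open>S\<close>, against \<open>no_daisy\<close>.\<close>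

lemma hexagon_free_if_indep:
  fixes n s :: nat
  assumes v: "v \<in> {..n} \<rightarrow> cube_vectors (Suc s)"
    and sub: "\<And>Y. Y \<in> \<V> \<Longrightarrow> Y \<subseteq> {..<n}"
    and ind: "\<And>Y. Y \<in> \<V> \<Longrightarrow> card Y = s \<and> indep v (insert n Y) \<or> card Y = Suc s \<and> indep v Y"
  shows "hexagon_free \<V>"
  unfolding hexagon_free_def
proof (intro allI impI notI)
  fix S a b c
  assume abc: "distinct [a, b, c]" "{a, b, c} \<inter> S = {}"
    and hex: "{insert a S, insert b S, insert c S,
      insert a (insert b S), insert b (insert c S), insert a (insert c S)} \<subseteq> \<V>"
  have mem: "insert a S \<in> \<V>" "insert b S \<in> \<V>" "insert c S \<in> \<V>" "insert a (insert b S) \<in> \<V>"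
    "insert b (insert c S) \<in> \<V>" "insert a (insert c S) \<in> \<V>"
    using hex by (simp_all only: insert_subset)
  have S: "insert a S \<subseteq> {..<n}" "insert b S \<subseteq> {..<n}" "insert c S \<subseteq> {..<n}"
    by (rule sub, rule mem)+
  have "S \<subseteq> {..<n}" using S(1) by simp
  then have fin: "finite S" using finite_lessThan by (rule finite_subset)
  have cards: "card (insert a S) = Suc (card S)" "card (insert b S) = Suc (card S)"
    "card (insert c S) = Suc (card S)" "card (insert a (insert b S)) = Suc (Suc (card S))"
    "card (insert b (insert c S)) = Suc (Suc (card S))" "card (insert a (insert c S)) = Suc (Suc (card S))"
    using fin abc by auto
  \<comment> \<open>The hexagon has vertices of two sizes, which must be \<open>s\<close> and
    \<open>Suc s\<close>. The dimension is therefore \<open>card S + 2\<close>.\<close>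
  have s: "s = Suc (card S)"
    using ind[OF mem(1)] ind[OF mem(4)] cards by auto
  have ind1: "indep v (insert n (insert a S))" "indep v (insert n (insert b S))" "indep v (insert n (insert c S))"
    using ind[OF mem(1)] ind[OF mem(2)] ind[OF mem(3)] cards s by auto
  have ind2: "indep v (insert a (insert b S))" "indep v (insert b (insert c S))" "indep v (insert a (insert c S))"
    using ind[OF mem(4)] ind[OF mem(5)] ind[OF mem(6)] cards s by auto
  have n: "n \<noteq> a" "n \<noteq> b" "n \<noteq> c" "n \<notin> S" using S by auto
  show False
  proof (rule no_daisy[OF bit_fun_char_2, of "cube_vectors (Suc s)" S "{a, b, c, n}" v])
    show "finite (cube_vectors (Suc s))" "card (cube_vectors (Suc s)) = 2 ^ (card S + 2)"
      by (simp_all add: card_cube_vectors s)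
    show "0 \<in> cube_vectors (Suc s)" by (simp add: cube_vectors_def)
    show "x + y \<in> cube_vectors (Suc s)" if "x \<in> cube_vectors (Suc s)" "y \<in> cube_vectors (Suc s)" for x y
      using that by (simp add: cube_vectors_def)
    show "card {a, b, c, n} = 4" "{a, b, c, n} \<inter> S = {}" using abc n by auto
    show "v i \<in> cube_vectors (Suc s)" if "i \<in> S \<union> {a, b, c, n}" for i
    proof -
      have "i \<in> {..n}" using that S by (auto simp: less_imp_le)
      then show ?thesis using v by blast
    qed
    show "indep v (insert p (insert q S))" if "p \<in> {a, b, c, n}" "q \<in> {a, b, c, n}" "p \<noteq> q" for p q
      using that ind1 ind2 by (elim insertE emptyE) (simp_all add: insert_commute)
  qed (use fin in auto)
qed

section \<open>Edges of the hypercube as pairs of lower endpoint and direction\<close>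

definition cube_pairs :: "nat \<Rightarrow> (nat set \<times> nat) set" where
  "cube_pairs n = {(A, x). A \<subseteq> {..<n} \<and> x < n \<and> x \<notin> A}"

definition bits :: "nat \<Rightarrow> nat set \<Rightarrow> bool list" where
  "bits n A = map (\<lambda>i. i \<in> A) [0..<n]"

definition support :: "bool list \<Rightarrow> nat set" where
  "support u = {i. i < length u \<and> u ! i}"

definition pair_edge :: "nat \<Rightarrow> nat set \<times> nat \<Rightarrow> bool list set" where
  "pair_edge n e = {bits n (fst e), bits n (insert (snd e) (fst e))}"

lemma support_bits: "A \<subseteq> {..<n} \<Longrightarrow> support (bits n A) = A"
  by (auto simp: support_def bits_def)

lemma bits_support: "bits (length u) (support u) = u"
  by (auto simp: support_def bits_def intro: nth_equalityI)

lemma length_bits [simp]: "length (bits n A) = n"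
  by (simp add: bits_def)

text \<open>The smaller of the two end sets is the lower endpoint, so the edge determines the
  pair.\<close>

lemma inj_on_pair_edge: "inj_on (pair_edge n) (cube_pairs n)"
proof (rule inj_onI, clarify)
  fix A x B y
  assume A: "(A, x) \<in> cube_pairs n" and B: "(B, y) \<in> cube_pairs n"
    and eq: "pair_edge n (A, x) = pair_edge n (B, y)"
  have "support ` pair_edge n (A, x) = {A, insert x A}" "support ` pair_edge n (B, y) = {B, insert y B}"
    using A B by (auto simp: pair_edge_def support_bits cube_pairs_def)
  then have "{A, insert x A} = {B, insert y B}" using eq by simp
  then have "A = B \<and> insert x A = insert y B"
    using A B by (auto simp: doubleton_eq_iff cube_pairs_def)
  then show "A = B \<and> x = y" using A B by (auto simp: cube_pairs_def)
qed

lemma pair_edge_image: "pair_edge n ` cube_pairs n = edges (hypercube n)"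
proof (intro equalityI subsetI)
  fix e assume "e \<in> pair_edge n ` cube_pairs n"
  then obtain A x where A: "A \<subseteq> {..<n}" "x < n" "x \<notin> A" and e: "e = {bits n A, bits n (insert x A)}"
    by (auto simp: pair_edge_def cube_pairs_def)
  have "{i. i < n \<and> bits n A ! i \<noteq> bits n (insert x A) ! i} = {x}"
    using A by (auto simp: bits_def)
  then have "card {i. i < n \<and> bits n A ! i \<noteq> bits n (insert x A) ! i} = 1"
    by simp
  then show "e \<in> edges (hypercube n)"
    unfolding hypercube_def e snd_conv
    by (intro CollectI exI[of _ "bits n A"] exI[of _ "bits n (insert x A)"] conjI length_bits refl)
next
  fix e assume "e \<in> edges (hypercube n)"
  then obtain u w where uw: "length u = n" "length w = n" and e: "e = {u, w}"
    and c: "card {i. i < n \<and> u ! i \<noteq> w ! i} = 1"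
    unfolding hypercube_def snd_conv by blast
  then obtain x where x: "{i. i < n \<and> u ! i \<noteq> w ! i} = {x}"
    by (metis card_1_singletonE)
  \<comment> \<open>The endpoint whose bit at \<open>x\<close> is false is named first; it is the
    lower one. The two orientations of the edge are distinguished afterwards.\<close>
  have main: "{p, q} \<in> pair_edge n ` cube_pairs n"
    if p: "length p = n" "length q = n" and d: "{i. i < n \<and> p ! i \<noteq> q ! i} = {x}" and nx: "\<not> p ! x" for p q
  proof -
    have "x \<in> {i. i < n \<and> p ! i \<noteq> q ! i}" using d by simp
    then have x: "x < n" "q ! x" using nx by simp_all
    have ne: "p ! i \<noteq> q ! i \<longleftrightarrow> i = x" if "i < n" for i
    proof -
      have "i \<in> {i. i < n \<and> p ! i \<noteq> q ! i} \<longleftrightarrow> i = x" unfolding d by simp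
      then show ?thesis using that by simp
    qed
    have "support q = insert x (support p)"
    proof (intro set_eqI)
      fix i show "i \<in> support q \<longleftrightarrow> i \<in> insert x (support p)"
        using ne[of i] x nx p by (cases "i < n") (auto simp: support_def)
    qed
    moreover have "(support p, x) \<in> cube_pairs n"
      using p x nx by (auto simp: cube_pairs_def support_def)
    moreover have "p = bits n (support p)" "q = bits n (support q)"
      using bits_support[of p] bits_support[of q] p by auto
    ultimately show ?thesis by (force simp: pair_edge_def)
  qed
  show "e \<in> pair_edge n ` cube_pairs n"
  proof (cases "u ! x")
    case False
    then show ?thesis unfolding e using main[of u w] uw x by blast
  next
    case True
    have x': "{i. i < n \<and> w ! i \<noteq> u ! i} = {x}" using x by auto
    then have "\<not> w ! x" using True by auto
    then show ?thesis unfolding e using main[of w u] uw x' by (metis insert_commute)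
  qed
qed

section \<open>The 10-cycle-free subgraph and its size\<close>

text \<open>All lower endpoints have sizes of parity \<open>p\<close>, so from a vertex of that
  parity the cycle can only go up and from any other only down. It therefore stays in two layers, is
  governed by a single assignment \<open>v s\<close>, and \<open>no_ten_cycle\<close>
  applies.\<close>

lemma pair_edges_ten_cycle_free:
  fixes n :: nat and p t :: bool and v :: "nat \<Rightarrow> nat \<Rightarrow> nat \<Rightarrow> bit"
  assumes G: "G \<subseteq> cube_pairs n"
    and v: "\<And>s. v s \<in> {..n} \<rightarrow> cube_vectors (Suc s)"
    and good: "\<And>A x. (A, x) \<in> G \<Longrightarrow> odd (card A) = p \<and> odd (card {a \<in> A. a < x}) = t
      \<and> indep (v (card A)) (insert x A) \<and> indep (v (card A)) (insert n A)"
  shows "\<not> contains_copy (verts (hypercube n), pair_edge n ` G) (cycle_graph 10)"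
proof
  assume "contains_copy (verts (hypercube n), pair_edge n ` G) (cycle_graph 10)"
  then obtain f :: "nat \<Rightarrow> bool list" where inj: "inj_on f {..<10}" and len: "\<And>j. j < 10 \<Longrightarrow> length (f j) = n"
    and edge: "\<And>j. j < 10 \<Longrightarrow> {f j, f ((j + 1) mod 10)} \<in> pair_edge n ` G"
  proof -
    obtain f :: "nat \<Rightarrow> bool list" where f: "inj_on f {..<10}" "f ` {..<10} \<subseteq> {u. length u = n}"
      and e: "\<forall>e\<in>{{i, (i + 1) mod 10} |i. i < 10}. f ` e \<in> pair_edge n ` G"
      using \<open>contains_copy _ _\<close> unfolding contains_copy_def cycle_graph_def hypercube_def fst_conv snd_conv
      by (elim exE conjE)
    have "{f j, f ((j + 1) mod 10)} \<in> pair_edge n ` G" if "j < 10" for j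
    proof -
      have "f ` {j, (j + 1) mod 10} \<in> pair_edge n ` G" using e that by blast
      then show ?thesis by simp
    qed
    moreover have "length (f j) = n" if "j < 10" for j using f(2) that by auto
    ultimately show thesis using that f(1) by presburger
  qed
  define X where "X j = support (f (j mod 10))" for j
  have fX: "f (j mod 10) = bits n (X j)" for j
  proof -
    have "length (f (j mod 10)) = n" by (rule len) simp
    then show ?thesis using bits_support[of "f (j mod 10)"] by (simp add: X_def)
  qed
  have Xsub: "X j \<subseteq> {..<n}" for j
    using len[of "j mod 10"] by (auto simp: X_def support_def)
  have "\<exists>A x. (A, x) \<in> G \<and> {X j, X (Suc j)} = {A, insert x A}" for j
  proof -
    have "{f (j mod 10), f (Suc j mod 10)} \<in> pair_edge n ` G"
      using edge[of "j mod 10"] by (simp add: mod_Suc_eq)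
    then obtain A x where Ax: "(A, x) \<in> G" and "{f (j mod 10), f (Suc j mod 10)} = pair_edge n (A, x)"
      by auto
    then have "{X j, X (Suc j)} = support ` pair_edge n (A, x)"
      unfolding X_def by (metis image_empty image_insert)
    also have "\<dots> = {A, insert x A}"
      using Ax G by (auto simp: pair_edge_def cube_pairs_def support_bits)
    finally show ?thesis using Ax by blast
  qed
  then obtain A d where AG: "\<And>j. (A j, d j) \<in> G" and AX: "\<And>j. {X j, X (Suc j)} = {A j, insert (d j) (A j)}"
    by metis
  have Ad: "d j \<notin> A j" "finite (A j)" "A j \<subseteq> {..<n}" for j
    using AG[of j] G finite_subset[of "A j" "{..<n}"] by (auto simp: cube_pairs_def)
  \<comment> \<open>\<open>U j\<close> says that \<open>X j\<close> is a lower endpoint, that is,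
    that step \<open>j\<close> goes up.\<close>
  define U where "U j \<longleftrightarrow> odd (card (X j)) = p" for j
  have cases: "U j \<and> X j = A j \<and> X (Suc j) = insert (d j) (A j) \<and> \<not> U (Suc j)
      \<or> \<not> U j \<and> X j = insert (d j) (A j) \<and> X (Suc j) = A j \<and> U (Suc j)" for j
  proof -
    have p: "odd (card (A j)) = p" using good[OF AG[of j]] by simp
    have "card (insert (d j) (A j)) = Suc (card (A j))" using Ad[of j] by simp
    then have "odd (card (insert (d j) (A j))) \<noteq> p" using p by simp
    moreover have "X j = A j \<and> X (Suc j) = insert (d j) (A j) \<or> X j = insert (d j) (A j) \<and> X (Suc j) = A j"
      using AX[of j] by (simp only: doubleton_eq_iff)
    ultimately show ?thesis using p unfolding U_def by (elim disjE conjE) simp_all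
  qed
  have upward: "X j = A j" "X (Suc j) = insert (d j) (A j)" if "U j" for j
    using cases[of j] that by simp_all
  have downward: "X j = insert (d j) (A j)" "X (Suc j) = A j" if "\<not> U j" for j
    using cases[of j] that by simp_all
  have alt: "U (Suc j) \<longleftrightarrow> \<not> U j" for j
    using cases[of j] by (elim disjE conjE) simp_all
  have "card (A (Suc j)) = card (A j)" for j
  proof (cases "U j")
    case True
    then have "insert (d (Suc j)) (A (Suc j)) = insert (d j) (A j)"
      using upward(2)[of j] downward(1)[of "Suc j"] alt by simp
    then have "card (insert (d (Suc j)) (A (Suc j))) = card (insert (d j) (A j))" by simp
    then show ?thesis using Ad[of j] Ad[of "Suc j"] by simp
  next
    case False
    then show ?thesis using downward(2)[of j] upward(1)[of "Suc j"] alt by simp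
  qed
  then have cA: "card (A j) = card (A 0)" for j by (induction j) auto
  \<comment> \<open>Starting the cycle \<open>k\<close> steps later puts its first vertex in the
    lower layer, as \<open>no_ten_cycle\<close> expects.\<close>
  define k where "k = (if U 0 then 0 else 1 :: nat)"
  have U: "U (j + k) \<longleftrightarrow> even j" for j
  proof (induction j)
    case 0
    show ?case using alt[of 0] by (simp add: k_def)
  next
    case (Suc j)
    then show ?case using alt[of "j + k"] by simp
  qed
  show False
  proof (rule no_ten_cycle[of "\<lambda>j. X (j + k)" "\<lambda>j. d (j + k)" t])
    show "X (j + 10 + k) = X (j + k)" for j
    proof -
      have "j + 10 + k = (j + k) + 10" by simp
      then show ?thesis by (simp only: X_def mod_add_self2)
    qed
    show "X (Suc (Suc j) + k) \<noteq> X (j + k)" for j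
    proof
      have mod_ne: "Suc (Suc m) mod 10 \<noteq> m mod 10" for m :: nat
        by presburger
      let ?m = "j + k"
      assume "X (Suc (Suc j) + k) = X ?m"
      then have "f (Suc (Suc ?m) mod 10) = f (?m mod 10)" by (simp only: fX add_Suc)
      then have "Suc (Suc ?m) mod 10 = ?m mod 10" by (rule inj_onD[OF inj]) simp_all
      then show False using mod_ne by blast
    qed
    show "finite (X (j + k))" for j
      using Xsub finite_subset by blast
    show "d (j + k) \<in> X (j + k) \<longleftrightarrow> odd j" for j
      using U[of j] Ad(1)[of "j + k"] upward(1)[of "j + k"] downward(1)[of "j + k"]
      by (cases "even j") simp_all
    show "x \<in> X (Suc j + k) \<longleftrightarrow> (x \<in> X (j + k)) \<noteq> (x = d (j + k))" for j x
      using Ad(1)[of "j + k"] upward[of "j + k"] downward[of "j + k"]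
      by (cases "U (j + k)"; cases "x = d (j + k)") simp_all
    show "odd (card {a \<in> X (j + k). a < d (j + k)}) = t" for j
    proof -
      \<comment> \<open>\<open>X (j + k)\<close> is the lower endpoint or adds
        \<open>d (j + k)\<close> to it, and this element is not below itself.\<close>
      have "{a \<in> X (j + k). a < d (j + k)} = {a \<in> A (j + k). a < d (j + k)}"
        using upward(1)[of "j + k"] downward(1)[of "j + k"] by (cases "U (j + k)") auto
      then show ?thesis using good[OF AG] by simp
    qed
    show "hexagon_free (range (\<lambda>j. X (j + k)))"
    proof (rule hexagon_free_if_indep[OF v[of "card (A 0)"]])
      fix Y assume "Y \<in> range (\<lambda>j. X (j + k))"
      then obtain j where Y: "Y = X j" by auto
      then show "Y \<subseteq> {..<n}" using Xsub by simp
      show "card Y = card (A 0) \<and> indep (v (card (A 0))) (insert n Y)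
        \<or> card Y = Suc (card (A 0)) \<and> indep (v (card (A 0))) Y"
        using upward(1)[of j] downward(1)[of j] good[OF AG[of j]] cA[of j] Ad[of j] unfolding Y
        by (cases "U j") simp_all
    qed
  qed
qed

text \<open>One of the four parity classes holds a quarter of the edges. In each layer a suitable
  assignment keeps half the infinite product of that class, and the union over all layers is free of
  10-cycles.\<close>

lemma ex_num_C10_ge:
  "(\<Prod>k. 1 - 1 / 2 ^ (k + 1)) / 8 * real (card (edges (hypercube n)))
     \<le> real (ex_num (hypercube n) (cycle_graph 10))"
proof -
  let ?c = "(\<Prod>k. 1 - 1 / 2 ^ (k + 1) :: real)"
  let ?E = "cube_pairs n"
  have cE: "card ?E = card (edges (hypercube n))"
    using card_image[OF inj_on_pair_edge] pair_edge_image by metis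
  have fE: "finite ?E"
    using finite_hypercube(2) inj_on_pair_edge pair_edge_image finite_image_iff by metis
  define col where "col e = (odd (card (fst e)), odd (card {a \<in> fst e. a < snd e}))"
    for e :: "nat set \<times> nat"
  obtain q where q: "card ?E \<le> 4 * card {e \<in> ?E. col e = q}"
  proof (rule ccontr)
    assume "\<not> thesis"
    then have less: "4 * card {e \<in> ?E. col e = q} < card ?E" for q using that not_le by blast
    have "card ?E = (\<Sum>q\<in>UNIV. card {e \<in> ?E. col e = q})"
      using fE by (subst card_UN_disjoint[symmetric]) (auto intro!: arg_cong[of _ _ card])
    then have "4 * card ?E = (\<Sum>q\<in>UNIV. 4 * card {e \<in> ?E. col e = q})"
      by (simp add: sum_distrib_left)
    also have "\<dots> < (\<Sum>q\<in>(UNIV :: (bool \<times> bool) set). card ?E)"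
      by (rule sum_strict_mono) (auto simp: less)
    also have "\<dots> = 4 * card ?E" by (simp add: card_cartesian_product UNIV_Times_UNIV[symmetric] del: UNIV_Times_UNIV)
    finally show False by simp
  qed
  obtain p t where pt: "q = (p, t)" by (cases q)
  \<comment> \<open>The class is split by the size of the lower endpoint, since each layer has its
    own dimension and assignment.\<close>
  define E where "E s = {e \<in> ?E. col e = q \<and> card (fst e) = s}" for s
  have fEs: "finite (E s)" for s using fE by (simp add: E_def)
  have "\<forall>s. \<exists>v. v \<in> {..n} \<rightarrow> cube_vectors (Suc s) \<and> ?c / 2 * real (card (E s))
      \<le> card {(A, x) \<in> E s. indep v (insert x A) \<and> indep v (insert n A)}"
    unfolding Bex_def[symmetric]
    by (intro allI exists_dense_indep[OF fEs]) (auto simp: E_def cube_pairs_def)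
  from choice[OF this] obtain v where vd: "\<forall>s. v s \<in> {..n} \<rightarrow> cube_vectors (Suc s) \<and> ?c / 2 * real (card (E s))
      \<le> card {(A, x) \<in> E s. indep (v s) (insert x A) \<and> indep (v s) (insert n A)}"
    by (elim exE)
  have v: "v s \<in> {..n} \<rightarrow> cube_vectors (Suc s)" for s
    using spec[OF vd, of s] by (rule conjunct1)
  have dense: "?c / 2 * real (card (E s))
      \<le> card {(A, x) \<in> E s. indep (v s) (insert x A) \<and> indep (v s) (insert n A)}" for s
    using spec[OF vd, of s] by (rule conjunct2)
  define Gs where "Gs s = {(A, x) \<in> E s. indep (v s) (insert x A) \<and> indep (v s) (insert n A)}" for s
  define G where "G = (\<Union>s\<le>n. Gs s)"
  have GsE: "Gs s \<subseteq> E s" for s by (auto simp: Gs_def)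
  have fGs: "finite (Gs s)" for s using GsE fEs finite_subset by blast
  have Gs_disj: "Gs i \<inter> Gs j = {}" if "i \<noteq> j" for i j
    using GsE[of i] GsE[of j] that by (fastforce simp: E_def)
  have EE: "{e \<in> ?E. col e = q} = (\<Union>s\<le>n. E s)"
  proof -
    have "card (fst e) \<le> n" if "e \<in> ?E" for e
      using that card_mono[of "{..<n}" "fst e"] by (auto simp: cube_pairs_def)
    then show ?thesis by (auto simp: E_def)
  qed
  have "real (card {e \<in> ?E. col e = q}) = (\<Sum>s\<le>n. real (card (E s)))"
    unfolding EE using fEs by (subst card_UN_disjoint) (auto simp: E_def)
  then have "?c / 2 * real (card {e \<in> ?E. col e = q}) = (\<Sum>s\<le>n. ?c / 2 * real (card (E s)))"
    by (simp add: sum_distrib_left)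
  also have "\<dots> \<le> (\<Sum>s\<le>n. real (card (Gs s)))"
    unfolding Gs_def by (intro sum_mono dense)
  also have "\<dots> = real (card G)"
    unfolding G_def using fGs Gs_disj by (subst card_UN_disjoint) auto
  finally have cG: "?c / 2 * real (card {e \<in> ?E. col e = q}) \<le> real (card G)" .
  have GE: "G \<subseteq> ?E" using GsE by (auto simp: G_def E_def)
  let ?F = "(verts (hypercube n), pair_edge n ` G)"
  have free: "\<not> contains_copy ?F (cycle_graph 10)"
  proof (rule pair_edges_ten_cycle_free[OF GE v])
    fix A x assume "(A, x) \<in> G"
    then show "odd (card A) = p \<and> odd (card {a \<in> A. a < x}) = t
      \<and> indep (v (card A)) (insert x A) \<and> indep (v (card A)) (insert n A)"
      by (auto simp: G_def Gs_def E_def col_def pt)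
  qed
  have "pair_edge n ` G \<subseteq> edges (hypercube n)"
    using GE pair_edge_image by blast
  then have sub: "subgraph ?F (hypercube n)"
    using simple_graph_hypercube[of n] by (auto simp: subgraph_def simple_graph_def)
  have "edges (cycle_graph 10) \<noteq> {}" by (auto simp: cycle_graph_def intro: exI[of _ 0])
  then have "card (edges ?F) \<le> ex_num (hypercube n) (cycle_graph 10)"
    unfolding ex_num_def using sub free by (intro Max_ge ex_num_set_hypercube(1)) blast+
  moreover have "card (edges ?F) = card G"
    using card_image[OF inj_on_subset[OF inj_on_pair_edge GE]] by simp
  ultimately have "real (card G) \<le> real (ex_num (hypercube n) (cycle_graph 10))" by simp
  moreover have "?c / 8 * real (card ?E) \<le> ?c / 2 * real (card {e \<in> ?E. col e = q})"
  proof -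
    have "?c / 8 * real (card ?E) \<le> ?c / 8 * real (4 * card {e \<in> ?E. col e = q})"
      using q prodinf_half_powers_pos by (intro mult_left_mono of_nat_mono) auto
    then show ?thesis by (simp add: mult.commute)
  qed
  ultimately show ?thesis using cG unfolding cE by linarith
qed

theorem theorem1p1:
  fixes n :: nat
  assumes "n \<ge> 1"
  shows "real (ex_num (hypercube n) (cycle_graph 10))
           > (\<Prod>k. 1 - 1 / 2 ^ (k + 1)) / 12 * real (card (edges (hypercube n)))"
proof -
  \<comment> \<open>For \<open>n \<ge> 1\<close> there is an edge, so passing from 1/8 to 1/12 makes
    the inequality strict.\<close>
  have "({}, 0) \<in> cube_pairs n" using assms by (simp add: cube_pairs_def)
  then have "edges (hypercube n) \<noteq> {}" using pair_edge_image by blast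
  then have "0 < real (card (edges (hypercube n)))"
    using finite_hypercube(2) by (simp add: card_gt_0_iff)
  then have "(\<Prod>k. 1 - 1 / 2 ^ (k + 1)) / 12 * real (card (edges (hypercube n)))
      < (\<Prod>k. 1 - 1 / 2 ^ (k + 1)) / 8 * real (card (edges (hypercube n)))"
    using prodinf_half_powers_pos by (intro mult_strict_right_mono) auto
  also have "\<dots> \<le> real (ex_num (hypercube n) (cycle_graph 10))"
    by (rule ex_num_C10_ge)
  finally show ?thesis .
qed

end
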